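(* Let $n\ge 2$ and $1\le m\le \binom{n}{2}$ be integers, and let $G$ be a graph with $n$ vertices and $m$ edges. Let $k^{*}=\max\{k\in\mathbb{Z}: \binom{k}{2}\le m\}$ and $t^{*}=m-\binom{k^{*}}{2}$. Then $$I_{d}(G)\ \geq\ \log(2m)-\frac{t^{*}k^{*}\log k^{*}+(k^{*}-t^{*})(k^{*}-1)\log(k^{*}-1)+t^{*}\log t^{*}}{2m},$$ and equality holds if and only if $G \cong K(k^{*},t^{*})\cup \overline{K}_{n-k^{*}-\sigma(t^{*})}$.
   Context: All graphs are simple, finite and undirected. Logarithms are base $2$, with the convention $0\log 0=0$. For a graph $G$ with vertices $v_1,\dots,v_n$, at least one edge, and degrees $d_G(v_i)$, the degree-based entropy is $$I_d(G)=-\sum_{i=1}^{n}\frac{d_G(v_i)}{\sum_{j=1}^n d_G(v_j)}\log\frac{d_G(v_i)}{\sum_{j=1}^n d_G(v_j)}.$$ $K_k$ is the complete graph on $k$ vertices, and $\overline{K}_r$ is its complement for $k=r$, i.e. the graph with $r$ vertices and no edges (the empty graph if $r=0$). $G\cup H$ denotes the (vertex-disjoint) union of graphs. For $1\le t\le k$, $K(k,t)$ is the graph obtained from $K_k$ by adding one new vertex adjacent to exactly $t$ vertices of $K_k$; for $t=0$, $K(k,0)=K_k$. The function $\sigma$ is defined by $\sigma(0)=0$ and $\sigma(x)=1$ for $x\neq 0$. *)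

theory Defs
  imports Complex_Main
begin

record 'a ugraph =
  verts :: "'a set"
  edges :: "'a set set"

definition simple_graph :: "'a ugraph \<Rightarrow> bool" where
  "simple_graph G \<longleftrightarrow> finite (verts G) \<and> (\<forall>e\<in>edges G. e \<subseteq> verts G \<and> card e = 2)"

definition vertex_degree :: "'a ugraph \<Rightarrow> 'a \<Rightarrow> nat" where
  "vertex_degree G v = card {e \<in> edges G. v \<in> e}"

text \<open>Since \<^term>\<open>log 2 0 = 0\<close> in HOL, isolated vertices contribute zero.\<close>

definition degree_entropy :: "'a ugraph \<Rightarrow> real" where
  "degree_entropy G =
     - (\<Sum>v\<in>verts G.
          real (vertex_degree G v) / (\<Sum>u\<in>verts G. real (vertex_degree G u)) *
          log 2 (real (vertex_degree G v) / (\<Sum>u\<in>verts G. real (vertex_degree G u))))"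

definition graph_iso :: "'a ugraph \<Rightarrow> 'b ugraph \<Rightarrow> bool" where
  "graph_iso G H \<longleftrightarrow>
     (\<exists>f. bij_betw f (verts G) (verts H) \<and>
          (\<forall>u\<in>verts G. \<forall>v\<in>verts G. {u, v} \<in> edges G \<longleftrightarrow> {f u, f v} \<in> edges H))"

definition disjoint_union :: "'a ugraph \<Rightarrow> 'b ugraph \<Rightarrow> ('a + 'b) ugraph" where
  "disjoint_union G H =
     \<lparr>verts = verts G <+> verts H,
      edges = (\<lambda>e. Inl ` e) ` edges G \<union> (\<lambda>e. Inr ` e) ` edges H\<rparr>"

definition complement_graph :: "'a ugraph \<Rightarrow> 'a ugraph" where
  "complement_graph G =
     \<lparr>verts = verts G, edges = {e. e \<subseteq> verts G \<and> card e = 2} - edges G\<rparr>"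

definition complete_graph :: "nat \<Rightarrow> nat ugraph" where
  "complete_graph k = \<lparr>verts = {..<k}, edges = {e. e \<subseteq> {..<k} \<and> card e = 2}\<rparr>"

text \<open>
  The graph \<open>K(k, t)\<close> for \<open>t \<le> k\<close>. The new vertex is \<open>k\<close>; its \<open>t\<close> neighbours are
  taken to be \<open>0, \<dots>, t - 1\<close>, any other choice giving an isomorphic graph.
\<close>

definition K_ext :: "nat \<Rightarrow> nat \<Rightarrow> nat ugraph" where
  "K_ext k t =
     (if t = 0 then complete_graph k
      else \<lparr>verts = insert k (verts (complete_graph k)),
            edges = edges (complete_graph k) \<union> {{k, i} | i. i < t}\<rparr>)"

definition sigma :: "nat \<Rightarrow> nat" where
  "sigma x = (if x = 0 then 0 else 1)"

end

theory Submission imports Defs begin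

text \<open>
  Writing \<open>f n = n ln n\<close>, the entropy of a graph with \<open>m\<close> edges is
  \<open>log (2m)\<close> minus a multiple of the energy \<open>\<Sum>\<^sub>v f (deg v)\<close>, so the energy has to be maximised;
  its claimed maximum is \<open>F k t\<close> for \<open>m = k(k-1)/2 + t\<close>, \<open>t < k\<close>. We argue by strong induction on \<open>m\<close>.
  Let \<open>G\<close> maximise the energy and let \<open>v\<close> be a vertex of minimal positive degree \<open>d\<close>. Convexity of
  \<open>f\<close> forces every neighbour of \<open>v\<close> to be adjacent to all \<open>N\<close> non-isolated vertices, hence the energy drops
  by exactly \<open>f d + d (f (N-1) - f (N-2))\<close> when \<open>v\<close> is removed.
  If \<open>N \<le> k + 1\<close>, then \<open>G\<close> is extremal or the induction hypothesis for \<open>G - v\<close> gives a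
  strict inequality. If \<open>N \<ge> k + 2\<close>, the energy of \<open>G - v\<close> is the sum of \<open>ln (deg u deg w)\<close> over its edges
  \<open>uw\<close>; replacing \<open>ln\<close> by its tangent at \<open>(k-1)\<^sup>2\<close> bounds it by the second Zagreb index
  \<open>\<Sum> deg u deg w\<close>, for which the minimum degree and the number of missing edges give a good estimate.
  This suffices unless \<open>d < t\<close> and \<open>f t - f (t - d) - f d\<close> is large, in which case the induction
  hypothesis applies again.
\<close>

subsection \<open>The function \<open>n ln n\<close> and its differences\<close>

text \<open>This upper bound and the lower bound that follows both agree with \<open>ln\<close> to
  second order at 1; they serve to estimate second differences of \<open>xlnx\<close>.\<close>

lemma ln_le_half_diff:
  fixes x :: real assumes "x \<ge> 1" shows "ln x \<le> (x - 1 / x) / 2"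
proof -
  let ?h = "\<lambda>y::real. (y - 1 / y) / 2 - ln y"
  have "?h 1 \<le> ?h x"
  proof (rule DERIV_nonneg_imp_nondecreasing[OF assms])
    fix y :: real assume "1 \<le> y"
    hence "(?h has_real_derivative (1 + 1 / y\<^sup>2) / 2 - 1 / y) (at y)"
      by (auto intro!: derivative_eq_intros simp: power2_eq_square)
    moreover have "(1 + 1 / y\<^sup>2) / 2 - 1 / y = (1 - 1 / y)\<^sup>2 / 2"
      using \<open>1 \<le> y\<close> by (simp add: power2_eq_square field_simps)
    ultimately show "\<exists>z. (?h has_real_derivative z) (at y) \<and> 0 \<le> z" by force
  qed
  thus ?thesis by simp
qed

lemma ln_ge_twice_quotient:
  fixes x :: real assumes "x \<ge> 1" shows "2 * (x - 1) / (x + 1) \<le> ln x"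
proof -
  let ?h = "\<lambda>y::real. ln y - (2 - 4 / (y + 1))"
  have "?h 1 \<le> ?h x"
  proof (rule DERIV_nonneg_imp_nondecreasing[OF assms])
    fix y :: real assume "1 \<le> y"
    hence "(?h has_real_derivative 1 / y - 4 / (y + 1)\<^sup>2) (at y)"
      by (auto intro!: derivative_eq_intros simp: power2_eq_square)
    moreover have "1 / y - 4 / (y + 1)\<^sup>2 = (y - 1)\<^sup>2 / (y * (y + 1)\<^sup>2)"
      using \<open>1 \<le> y\<close> by (simp add: divide_simps) (simp add: power2_eq_square algebra_simps)
    ultimately show "\<exists>z. (?h has_real_derivative z) (at y) \<and> 0 \<le> z" using \<open>1 \<le> y\<close>
      by force
  qed
  moreover have "2 - 4 / (x + 1) = 2 * (x - 1) / (x + 1)" using assms by (simp add: field_simps)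
  ultimately show ?thesis by simp
qed

definition xlnx :: "nat \<Rightarrow> real" where "xlnx n = real n * ln (real n)"

text \<open>The gain in energy when a vertex of degree \<open>n\<close> receives one more
  edge.\<close>

definition gap :: "nat \<Rightarrow> real" where "gap n = xlnx (Suc n) - xlnx n"

lemma xlnx_0 [simp]: "xlnx 0 = 0" by (simp add: xlnx_def)

lemma gap_second_diff:
  assumes "n \<ge> 1"
  shows "gap n - gap (n - 1) = (real n + 1) * ln ((real n + 1) / n) - (real n - 1) * ln (real n / (real n - 1))"
  using assms unfolding gap_def xlnx_def
  by (cases "n = 1") (auto simp: ln_div of_nat_diff algebra_simps)

text \<open>Strict convexity of \<open>xlnx\<close>. In \<open>gap_second_diff\<close> the first
  term exceeds 1 by \<open>ln_ge_twice_quotient\<close>, and the second is at most 1 by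
  \<open>ln x <= x - 1\<close>.\<close>

lemma gap_strict_mono_Suc: assumes "n \<ge> 1" shows "gap (n - 1) < gap n"
proof (cases "n = 1")
  case True thus ?thesis by (simp add: gap_def xlnx_def)
next
  case False
  hence n: "real n \<ge> 2" using assms by linarith
  have "2 * ((real n + 1) / n - 1) / ((real n + 1) / n + 1) \<le> ln ((real n + 1) / n)"
    by (rule ln_ge_twice_quotient) (use n in simp)
  moreover have "2 * ((real n + 1) / n - 1) / ((real n + 1) / n + 1) = 2 / (2 * real n + 1)"
    using n by (simp add: divide_simps)
  ultimately have "(real n + 1) * (2 / (2 * real n + 1)) \<le> (real n + 1) * ln ((real n + 1) / n)"
    using n by (intro mult_left_mono) auto
  moreover have "(real n + 1) * (2 / (2 * real n + 1)) > 1" using n by (simp add: field_simps)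
  moreover have "(real n - 1) * ln (real n / (real n - 1)) \<le> (real n - 1) * (real n / (real n - 1) - 1)"
    using n by (intro mult_left_mono ln_le_minus_one) auto
  moreover have "(real n - 1) * (real n / (real n - 1) - 1) = 1" using n by (simp add: field_simps)
  ultimately show ?thesis using gap_second_diff[OF assms] by linarith
qed

text \<open>In \<open>gap_second_diff\<close> the first term is at most \<open>1 + 1 / (2 n)\<close>
  and the second at least \<open>1 - 1 / (2 n - 1)\<close>; both corrections are below
  \<open>1 / (2 (n - 1))\<close>.\<close>

lemma gap_diff_less: assumes "n \<ge> 2" shows "gap n - gap (n - 1) < 1 / (real n - 1)"
proof -
  have n: "real n \<ge> 2" using assms by simp
  have "ln ((real n + 1) / n) \<le> ((real n + 1) / n - n / (real n + 1)) / 2"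
    using ln_le_half_diff[of "(real n + 1) / n"] n by simp
  hence "(real n + 1) * ln ((real n + 1) / n) \<le> (real n + 1) * (((real n + 1) / n - n / (real n + 1)) / 2)"
    using n by (intro mult_left_mono) auto
  also have "\<dots> = 1 + 1 / (2 * n)"
    using n by (simp add: divide_simps) (simp add: algebra_simps)
  finally have A: "(real n + 1) * ln ((real n + 1) / n) \<le> 1 + 1 / (2 * n)" .
  have "2 * (real n / (real n - 1) - 1) / (real n / (real n - 1) + 1) \<le> ln (real n / (real n - 1))"
    by (rule ln_ge_twice_quotient) (use n in simp)
  moreover have "2 * (real n / (real n - 1) - 1) / (real n / (real n - 1) + 1) = 2 / (2 * real n - 1)"
    using n by (simp add: divide_simps)
  ultimately have "(real n - 1) * (2 / (2 * real n - 1)) \<le> (real n - 1) * ln (real n / (real n - 1))"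
    using n by (intro mult_left_mono) auto
  moreover have "(real n - 1) * (2 / (2 * real n - 1)) = 1 - 1 / (2 * real n - 1)"
    using n by (simp add: field_simps)
  ultimately have "gap n - gap (n - 1) \<le> 1 / (2 * n) + 1 / (2 * real n - 1)"
    using A gap_second_diff[of n] assms by simp
  also have "1 / (2 * n) < 1 / (2 * (real n - 1))" using n by (simp add: field_simps)
  also have "1 / (2 * real n - 1) < 1 / (2 * (real n - 1))" using n by (simp add: field_simps)
  also have "1 / (2 * (real n - 1)) + 1 / (2 * (real n - 1)) = 1 / (real n - 1)" using n by (simp add: field_simps)
  finally show ?thesis by simp
qed

text \<open>The second difference extends to a function of a real variable with derivative
  \<open>ln ((x^2 - 1) / x^2) < 0\<close>.\<close>

lemma gap_strict_concave_Suc: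
  assumes "n \<ge> 1" shows "gap (Suc n) - gap n < gap n - gap (n - 1)"
proof (cases "n = 1")
  case True
  \<comment> \<open>The derivative argument needs \<open>x > 1\<close>; for \<open>n = 1\<close> the
    claim amounts to \<open>3 ln 3 < 6 ln 2\<close>.\<close>
  have "ln (27::real) < ln 64" by simp
  moreover have "ln (27::real) = 3 * ln 3" "ln (64::real) = 6 * ln 2"
    using ln_realpow[of "3::real" 3] ln_realpow[of "2::real" 6] by auto
  ultimately show ?thesis using True by (simp add: gap_def xlnx_def eval_nat_numeral)
next
  case False
  hence n: "real n > 1" using assms by linarith
  let ?h = "\<lambda>x::real. (x + 1) * ln (x + 1) - 2 * (x * ln x) + (x - 1) * ln (x - 1)"
  have "?h (real n + 1) < ?h n"
  proof (rule DERIV_neg_imp_decreasing[where f = ?h])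
    show "real n < real n + 1" by simp
  next
    fix x :: real assume "real n \<le> x" "x \<le> real n + 1"
    hence x: "x > 1" using n by simp
    hence "(?h has_real_derivative ln (x + 1) - 2 * ln x + ln (x - 1)) (at x)"
      by (auto intro!: derivative_eq_intros)
    moreover have "ln (x + 1) - 2 * ln x + ln (x - 1) = ln ((x + 1) * (x - 1)) - ln (x\<^sup>2)"
      using x by (simp add: ln_mult ln_realpow)
    moreover have "ln ((x + 1) * (x - 1)) < ln (x\<^sup>2)"
      using x by (subst ln_less_cancel_iff) (auto simp: power2_eq_square algebra_simps less_1_mult)
    ultimately show "\<exists>y. (?h has_real_derivative y) (at x) \<and> y < 0" by force
  qed
  thus ?thesis using n by (simp add: gap_def xlnx_def of_nat_diff algebra_simps)
qed

section \<open>The extremal energy and the removal of a vertex\<close>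

text \<open>The value \<open>F k t\<close> of the overview, the energy of K(k,t): \<open>k\<close>
  vertices of degree \<open>k - 1\<close>, of which \<open>t\<close> are raised to degree
  \<open>k\<close> by a new vertex of degree \<open>t\<close>.\<close>

definition extremal_energy :: "nat \<Rightarrow> nat \<Rightarrow> real" where
  "extremal_energy k t = real k * xlnx (k - 1) + real t * gap (k - 1) + xlnx t"

lemma gap_strict_mono: "strict_mono gap"
  using gap_strict_mono_Suc[of "Suc n" for n] by (simp add: strict_mono_Suc_iff)

lemma gap_mono: "i \<le> j \<Longrightarrow> gap i \<le> gap j"
  using strict_mono_less_eq[OF gap_strict_mono] by blast

text \<open>Telescoping: each of the \<open>j\<close> second differences beyond \<open>a\<close> is
  below \<open>1 / a\<close>.\<close>

lemma gap_diff_less_quotient: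
  assumes "a \<ge> 1" and "j \<ge> 1" shows "gap (a + j) - gap a < real j / real a"
  using assms(2)
proof (induction j rule: dec_induct)
  case base
  show ?case using gap_diff_less[of "a + 1"] assms(1) by simp
next
  case (step j)
  have "gap (a + Suc j) - gap (a + j) < 1 / real (a + j)"
    using gap_diff_less[of "a + Suc j"] assms(1) by simp
  also have "\<dots> \<le> 1 / real a" using assms(1) by (simp add: frac_le)
  finally show ?case using step.IH by (simp add: add_divide_distrib)
qed

lemma gap_second_diff_antimono:
  assumes "1 \<le> i" "i < j" shows "gap j - gap (j - 1) < gap i - gap (i - 1)"
proof -
  have "strict_mono (\<lambda>n. gap n - gap (Suc n))"
    using gap_strict_concave_Suc[of "Suc n" for n] by (simp add: strict_mono_Suc_iff algebra_simps)
  moreover have "i - 1 < j - 1" using assms by simp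
  ultimately have "gap (i - 1) - gap (Suc (i - 1)) < gap (j - 1) - gap (Suc (j - 1))"
    by (rule strict_monoD)
  thus ?thesis using assms by simp
qed

text \<open>Passing from \<open>s\<close> to \<open>s + 1\<close> adds
  \<open>gap (d - s - 1)\<close> and the second difference at \<open>a\<close> on the left, and
  \<open>gap (a - s - 1)\<close> on the right. Since \<open>d < a\<close>, the first gap is at most
  \<open>gap (a - s - 2)\<close>; since second differences decrease strictly, the right side gains
  more.\<close>

lemma xlnx_diff_shift:
  assumes "1 \<le> s" "s \<le> d" "d < a"
  shows "xlnx d - xlnx (d - s) + real s * (gap a - gap (a - 1)) < xlnx a - xlnx (a - s)"
  using assms
proof (induction s rule: dec_induct)
  case base
  have "gap (d - 1) \<le> gap (a - 2)"
    using base by (intro gap_mono) auto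
  moreover have "gap a - gap (a - 1) < gap (a - 1) - gap (a - 2)"
    using gap_second_diff_antimono[of "a - 1" a] base by (simp add: numeral_2_eq_2)
  ultimately show ?case using base by (simp add: gap_def)
next
  case (step s)
  have 1: "gap (d - Suc s) \<le> gap (a - Suc s - 1)"
    using step by (intro gap_mono) auto
  have 2: "gap a - gap (a - 1) < gap (a - Suc s) - gap (a - Suc s - 1)"
    using gap_second_diff_antimono[of "a - Suc s" a] step by simp
  have "gap (d - Suc s) = xlnx (d - s) - xlnx (d - Suc s)"
       "gap (a - Suc s) = xlnx (a - s) - xlnx (a - Suc s)"
    using step by (auto simp: gap_def Suc_diff_Suc)
  with 1 2 step show ?case by (simp add: algebra_simps)
qed

text \<open>For the case of \<open>k + 1\<close> non-isolated vertices with \<open>t < d\<close>: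
  the left side is the inductive bound for the graph without \<open>v\<close> plus the energy lost
  with \<open>v\<close>. After cancellation, \<open>xlnx_diff_shift\<close> remains for
  \<open>a = k - 1\<close> and \<open>s = d - t\<close>.\<close>

lemma extremal_energy_remove:
  assumes "t < d" and "d + 2 \<le> k"
  shows "extremal_energy (k - 1) (k - 1 - (d - t)) + xlnx d + real d * gap (k - 1) < extremal_energy k t"
proof -
  obtain a where k: "k = Suc a" and a: "d < a" using assms(2) by (cases k) auto
  define s where "s = d - t"
  have s: "1 \<le> s" "s \<le> d" "t = d - s" using assms by (auto simp: s_def)
  have "real a * xlnx (a - 1) + real a * gap (a - 1) = real a * xlnx a"
    using a by (simp add: gap_def algebra_simps)
  moreover have "extremal_energy a (a - s) = real a * xlnx (a - 1) + real a * gap (a - 1) - real s * gap (a - 1) + xlnx (a - s)"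
    using s a by (simp add: extremal_energy_def of_nat_diff algebra_simps)
  moreover have "extremal_energy k t = real a * xlnx a + xlnx a + real d * gap a - real s * gap a + xlnx (d - s)"
    using s a by (simp add: extremal_energy_def k of_nat_diff algebra_simps)
  moreover note xlnx_diff_shift[OF s(1,2) a]
  ultimately show ?thesis using k s_def by (simp add: algebra_simps)
qed

text \<open>
  With \<open>a = k - 1\<close>, this bounds the energy of \<open>G\<close> when \<open>v\<close> has degree \<open>d\<close> and \<open>G\<close> has \<open>a + 2 + j\<close>
  non-isolated vertices: \<open>G - v\<close> has \<open>m\<close> edges and \<open>M\<close> non-edges.
\<close>

definition removal_bound :: "nat \<Rightarrow> nat \<Rightarrow> nat \<Rightarrow> nat \<Rightarrow> real" where
  "removal_bound a j d t =
     (let m = (real a + 1) * real a / 2 + real t - real d;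
          M = (real a + 1 + real j) * (real a + real j) / 2 - m
      in 2 * m * ln (real a) - m + (2 * m\<^sup>2 - m * (real a + real j) - M * real d * (real d - 1)) / (real a)\<^sup>2
         + xlnx d + real d * gap (a + j))"

section \<open>The removal bound lies below the extremal energy\<close>

text \<open>The main terms \<open>(a + 1) a ln a\<close> cancel. What remains depends on the signed
  difference \<open>s = d - t\<close> and is estimated term by term, first for
  \<open>s >= 0\<close>, then for \<open>s < 0\<close>.\<close>

lemma removal_bound_eq:
  assumes a: "a \<ge> 1" and s: "s = real d - real t"
  shows "removal_bound a j d t - extremal_energy (a + 1) t =
    xlnx d - xlnx t - s * ln a + s * ((real a + 1) * ln ((real a + 1) / a) - (real a + 1) / a)
    + 2 * s\<^sup>2 / a\<^sup>2 + d * (gap (a + j) - gap a) - j * ((real a + 1) / (2 * a) - s / a\<^sup>2)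
    - (j * (real a + 1) + real j * (real j - 1) / 2 + s) * d * (real d - 1) / a\<^sup>2"
proof -
  define A where "A = real a"
  define L where "L = ln A"
  define K where "K = ln (A + 1)"
  have A: "A > 0" using a by (simp add: A_def)
  have g: "gap a = (A + 1) * K - A * L" by (simp add: gap_def xlnx_def A_def L_def K_def add.commute)
  have q: "ln ((A + 1) / A) = K - L" using A by (simp add: K_def L_def ln_div)
  have t: "real t = real d - s" using s by simp
  have E: "extremal_energy (a + 1) t = (A + 1) * (A * L) + (real d - s) * ((A + 1) * K - A * L) + xlnx t"
    by (simp add: extremal_energy_def xlnx_def g[unfolded gap_def xlnx_def] gap_def t A_def L_def K_def add.commute)
  show ?thesis
    unfolding removal_bound_def Let_def E g A_def[symmetric] L_def[symmetric] q t
    using A by (simp add: divide_simps) (simp add: power2_eq_square algebra_simps)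
qed

text \<open>The case \<open>s >= 0\<close>. The terms of \<open>removal_bound_eq\<close> are
  replaced by rational bounds (\<open>H1\<close> to \<open>H3\<close>), which reduces the claim to
  the rational inequality \<open>E\<close>. The assumption \<open>size\<close> stems from the degree
  sum, to which \<open>d\<close> dominating vertices contribute fully and all others at least
  \<open>d\<close>.\<close>

lemma removal_bound_less_ge:
  assumes a: "2 \<le> a" and j: "1 \<le> j" and d: "1 \<le> d" "d \<le> a" and td: "t \<le> d"
    and size: "real d * (2 * real a + 5 - real d) \<le> real a * (real a + 1) + 2 * real t"
  shows "removal_bound a j d t < extremal_energy (a + 1) t"
proof -
  have a1: "1 \<le> a" using a by simp
  define s where "s = real d - real t"
  define A D J where "A = real a" and "D = real d" and "J = real j"
  have s0: "0 \<le> s" "s \<le> D" using td by (auto simp: s_def D_def)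
  have A: "A \<ge> 2" and D: "D \<ge> 1" "D \<le> A" and J: "J \<ge> 1" using a d j by (auto simp: A_def D_def J_def)
  \<comment> \<open>Tangent to \<open>ln\<close> at 1/2, combined with
    \<open>ln 2 >= 2/3\<close>.\<close>
  have "ln (D / A) = ln (2 * (D / A)) - ln 2" using A D by (simp add: ln_mult ln_div)
  also have "\<dots> \<le> 2 * (D / A) - 1 - 2 / 3"
    using ln_ge_twice_quotient[of 2] ln_le_minus_one[of "2 * (D / A)"] A D by simp
  finally have lnq: "s * ln (D / A) \<le> s * (2 * (D / A) - 1 - 2 / 3)" using s0 by (intro mult_left_mono) auto
  have "xlnx d - xlnx t - s * ln A \<le> s - s\<^sup>2 / (2 * D) + s * ln (D / A)"
  proof (cases "t = 0")
    case True
    thus ?thesis using D A by (simp add: s_def xlnx_def ln_div algebra_simps power2_eq_square flip: D_def)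
  next
    case False
    define T where "T = real t"
    have T: "T \<ge> 1" "T \<le> D" "T = D - s" using False td by (auto simp: T_def D_def s_def)
    have "T * ln (D / T) \<le> T * ((D / T - 1 / (D / T)) / 2)"
      using T by (intro mult_left_mono ln_le_half_diff) auto
    also have "\<dots> = s - s\<^sup>2 / (2 * D)"
    proof -
      have s: "s = D - T" using T by simp
      show ?thesis using T(1) D(1) unfolding s by (simp add: field_simps power2_eq_square)
    qed
    finally have *: "T * ln (D / T) \<le> s - s\<^sup>2 / (2 * D)" .
    have X: "xlnx d = D * ln D" "xlnx t = T * ln T" by (simp_all add: xlnx_def D_def T_def)
    have L: "ln (D / T) = ln D - ln T" "ln (D / A) = ln D - ln A" using T(1) A D by (auto simp: ln_div)
    have S: "s = D - T" using T by simp
    have "xlnx d - xlnx t - s * ln A = T * ln (D / T) + s * ln (D / A)"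
      unfolding X L S by (simp add: algebra_simps)
    with * show ?thesis by simp
  qed
  with lnq have H1: "xlnx d - xlnx t - s * ln A \<le> s * (2 * (D / A) - 2 / 3) - s\<^sup>2 / (2 * D)"
    by (simp add: algebra_simps)
  have "(A + 1) * ln ((A + 1) / A) \<le> (A + 1) * ((A + 1) / A - 1)"
    using A by (intro mult_left_mono ln_le_minus_one) auto
  also have "\<dots> = (A + 1) / A" using A by (simp add: field_simps)
  finally have H2: "s * ((A + 1) * ln ((A + 1) / A) - (A + 1) / A) \<le> 0"
    using s0 by (intro mult_nonneg_nonpos) auto
  have "gap (a + j) - gap a < J / A" using gap_diff_less_quotient[of a j] a j by (simp add: A_def J_def)
  hence H3: "D * (gap (a + j) - gap a) < D * (J / A)" using D by (intro mult_strict_left_mono) auto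
  have J1: "0 \<le> J * (J - 1) / 2 * D * (D - 1) / A\<^sup>2" using J D by simp
  have E: "s * (2 * (D / A) - 2 / 3) - s\<^sup>2 / (2 * D) + 2 * s\<^sup>2 / A\<^sup>2 + D * (J / A)
      - J * ((A + 1) / (2 * A) - s / A\<^sup>2) - (J * (A + 1) + s) * D * (D - 1) / A\<^sup>2 \<le> 0" (is "?E \<le> 0")
  proof (cases "s = 0")
    case True
    have "D * A - (A + 1) * A / 2 - (A + 1) * D * (D - 1) \<le> 0"
    proof (cases "d = 1")
      case True thus ?thesis using A by (simp add: D_def algebra_simps) 
    next
      case False
      hence "D \<ge> 2" using d by (simp add: D_def)
      hence "(A + 1) * D * 1 \<le> (A + 1) * D * (D - 1)" using A by (intro mult_left_mono) auto
      moreover have "0 \<le> (A + 1) * A / 2" using A by simp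
      moreover have "D * A \<le> (A + 1) * D * 1" using D by (simp add: algebra_simps)
      ultimately show ?thesis by linarith
    qed
    hence "J / A\<^sup>2 * (D * A - (A + 1) * A / 2 - (A + 1) * D * (D - 1)) \<le> 0"
      using J by (intro mult_nonneg_nonpos) auto
    also have "J / A\<^sup>2 * (D * A - (A + 1) * A / 2 - (A + 1) * D * (D - 1)) = ?E"
      using A True by (simp add: divide_simps) (simp add: algebra_simps power2_eq_square)
    finally show ?thesis .
  next
    case False
    hence t: "real t \<le> D - 1" using td by (simp add: s_def D_def)
    have size': "D * (2 * A + 3 - D) \<le> A * (A + 1) - 2"
      using size t by (simp add: A_def D_def algebra_simps)
    \<comment> \<open>For \<open>t < d\<close> the size condition rules out all other pairs with
      \<open>a <= 4\<close>; for \<open>a <= 5\<close> the polynomial inequality below is checked by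
      evaluation.\<close>
    have cases: "(a = 3 \<and> d = 1) \<or> (a = 4 \<and> d \<le> 2) \<or> (a = 5 \<and> d \<le> 5) \<or> a \<ge> 6"
    proof -
      have "a = 2 \<or> a = 3 \<or> a = 4 \<or> a = 5 \<or> a \<ge> 6" using a by linarith
      moreover have "d = 1 \<or> d = 2 \<or> d = 3 \<or> d = 4 \<or> d \<ge> 5" using d by linarith
      ultimately show ?thesis using size' d by (auto simp: A_def D_def)
    qed
    \<comment> \<open>This lets the negative term \<open>s^2 / (2 D)\<close> absorb
      \<open>2 s^2 / A^2\<close>, so that a bound linear in \<open>s\<close> remains.\<close>
    have "4 * D \<le> A\<^sup>2"
    proof (cases "a = 3")
      case True thus ?thesis using cases by (simp add: A_def D_def)
    next
      case False
      hence "A \<ge> 4" using cases by (auto simp: A_def)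
      hence "4 * D \<le> A * A" using D by (intro mult_mono) auto
      thus ?thesis by (simp add: power2_eq_square)
    qed
    hence "2 / A\<^sup>2 \<le> 1 / (2 * D)" using A D by (simp add: field_simps)
    hence "s\<^sup>2 * (2 / A\<^sup>2) \<le> s\<^sup>2 * (1 / (2 * D))" by (intro mult_left_mono) auto
    hence 1: "2 * s\<^sup>2 / A\<^sup>2 \<le> s\<^sup>2 / (2 * D)" by (simp add: field_simps)
    have 2: "J * (s / A\<^sup>2) \<le> J * (D / A\<^sup>2)" using s0 J A by (intro mult_left_mono divide_right_mono) auto
    \<comment> \<open>The bound takes the form \<open>s * B + J * C\<close> with
      \<open>C <= 0\<close>. As \<open>s <= D\<close> and \<open>J >= 1\<close>, only
      \<open>D * B + C <= 0\<close> has to be shown when \<open>B > 0\<close>.\<close>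
    define B C where "B = 2 * (D / A) - 2 / 3 - D * (D - 1) / A\<^sup>2"
      and "C = (A + 1) * (2 * D - D\<^sup>2 - A / 2) / A\<^sup>2"
    have "?E \<le> s * (2 * (D / A) - 2 / 3) + D * (J / A)
      - J * ((A + 1) / (2 * A)) + J * (D / A\<^sup>2) - (J * (A + 1) + s) * D * (D - 1) / A\<^sup>2"
      using 1 2 by (simp add: algebra_simps)
    also have "\<dots> = s * B + J * C"
      using A unfolding B_def C_def
      by (simp add: divide_simps) (simp add: power2_eq_square algebra_simps)
    also have "\<dots> \<le> 0"
    proof -
      have "(D - 1)\<^sup>2 \<ge> 0" by simp
      hence "2 * D - D\<^sup>2 - A / 2 \<le> 0" using A by (simp add: power2_eq_square algebra_simps)
      hence "(A + 1) * (2 * D - D\<^sup>2 - A / 2) \<le> 0" using A by (intro mult_nonneg_nonpos) auto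
      hence C: "C \<le> 0" using A by (simp add: C_def divide_nonpos_nonneg)
      hence JC: "J * C \<le> C" using J mult_right_mono_neg[of 1 J C] by simp
      show ?thesis
      proof (cases "B \<le> 0")
        case True
        have "s * B \<le> 0" using True s0 by (intro mult_nonneg_nonpos)
        thus ?thesis using JC C by linarith
      next
        case False
        have "s * B \<le> D * B" using False s0 by (intro mult_right_mono) auto
        moreover have "D * B + C \<le> 0"
        proof -
          \<comment> \<open>The coefficient 5/12 is \<open>2/3 - 1/4\<close>, from
            \<open>D^2 - D A + 2/3 A^2 = (D - A / 2)^2 + 5/12 A^2\<close>.\<close>
          have sq: "0 \<le> (D - A / 2)\<^sup>2" by simp
          have "- (5 / 12) * D * A\<^sup>2 + 2 * D * (A + 1) - A * (A + 1) / 2 \<le> 0"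
            using cases
          proof (elim disjE conjE)
            assume "6 \<le> a"
            hence "A \<ge> 6" by (simp add: A_def)
            hence "6 * A \<le> A\<^sup>2" by (simp add: power2_eq_square)
            hence "5 / 12 * (6 * A) \<le> 5 / 12 * A\<^sup>2" by (rule mult_left_mono) simp
            moreover have "2 * (A + 1) \<le> 5 / 12 * (6 * A)" using \<open>A \<ge> 6\<close> by simp
            ultimately have "2 * (A + 1) \<le> 5 / 12 * A\<^sup>2" by (rule order_trans[rotated])
            hence "D * (2 * (A + 1)) \<le> D * (5 / 12 * A\<^sup>2)" using D by (intro mult_left_mono) auto
            moreover have "0 \<le> A * (A + 1) / 2" using A by simp
            ultimately show ?thesis by linarith
          qed (auto simp: A_def D_def power2_eq_square)
          moreover have "D * (A\<^sup>2 * 5 / 12) \<le> D * (D\<^sup>2 - D * A + 2 / 3 * A\<^sup>2)"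
            using sq D by (intro mult_left_mono) (auto simp: power2_eq_square algebra_simps)
          ultimately have "- D * (D\<^sup>2 - D * A + 2 / 3 * A\<^sup>2) + 2 * D * (A + 1) - A * (A + 1) / 2 \<le> 0"
            by (simp add: algebra_simps)
          hence "(- D * (D\<^sup>2 - D * A + 2 / 3 * A\<^sup>2) + 2 * D * (A + 1) - A * (A + 1) / 2) / A\<^sup>2 \<le> 0"
            by (simp add: divide_nonpos_nonneg)
          also have "(- D * (D\<^sup>2 - D * A + 2 / 3 * A\<^sup>2) + 2 * D * (A + 1) - A * (A + 1) / 2) / A\<^sup>2 = D * B + C"
            using A unfolding B_def C_def
            by (simp add: divide_simps) (simp add: power2_eq_square algebra_simps)
          finally show ?thesis .
        qed
        ultimately show ?thesis using JC by linarith
      qed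
    qed
    finally show ?thesis .
  qed
  have M: "(J * (A + 1) + J * (J - 1) / 2 + s) * D * (D - 1) / A\<^sup>2
      = (J * (A + 1) + s) * D * (D - 1) / A\<^sup>2 + J * (J - 1) / 2 * D * (D - 1) / A\<^sup>2"
    by (simp add: algebra_simps add_divide_distrib diff_divide_distrib)
  have arith: "x1 + x2 + x3 + x4 - x5 - (x6 + x7) < 0"
    if "x1 \<le> p" "x2 \<le> 0" "x4 < q" "0 \<le> x7" "p + x3 + q - x5 - x6 \<le> 0"
    for x1 x2 x3 x4 x5 x6 x7 p q :: real using that by linarith
  from H1 H2 H3 J1 E have "removal_bound a j d t - extremal_energy (a + 1) t < 0"
    unfolding removal_bound_eq[OF a1 s_def] A_def[symmetric] D_def[symmetric] J_def[symmetric] M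
    by (rule arith)
  thus ?thesis by simp
qed

text \<open>The case \<open>s < 0\<close>. The assumption \<open>small\<close> says that the
  inductive bound with \<open>t - d\<close> in place of \<open>t\<close> does not already give the
  strict inequality. It forces \<open>r = t - d\<close> below \<open>J / 2 * (T / A)\<close>, so
  that all terms in \<open>r\<close> are dominated by the negative term linear in
  \<open>J\<close>.\<close>

lemma removal_bound_less_lt:
  assumes a: "2 \<le> a" and j: "1 \<le> j" and d: "1 \<le> d" "d < t" and t: "t \<le> a"
    and small: "xlnx t - xlnx (t - d) - xlnx d \<le> real d * (gap (a + j) - gap a)"
  shows "removal_bound a j d t < extremal_energy (a + 1) t"
proof -
  have a1: "1 \<le> a" using a by simp
  define s where "s = real d - real t"
  define A D J T r where "A = real a" and "D = real d" and "J = real j" and "T = real t" and "r = real t - real d"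
  have s: "s = - r" by (simp add: s_def r_def)
  have r: "r \<ge> 1" "r = T - D" using d by (auto simp: r_def T_def D_def)
  have A: "A \<ge> 2" and D: "D \<ge> 1" and T: "T \<ge> 2" "T \<le> A" and J: "J \<ge> 1"
    using a d j t by (auto simp: A_def D_def J_def T_def)
  have "gap (a + j) - gap a < J / A" using gap_diff_less_quotient[of a j] a j by (simp add: A_def J_def)
  hence H3: "D * (gap (a + j) - gap a) < D * (J / A)" using D by (intro mult_strict_left_mono) auto
  have X: "xlnx t = T * ln T" "xlnx d = D * ln D" "xlnx (t - d) = r * ln r"
    using d by (simp_all add: xlnx_def T_def D_def r_def of_nat_diff)
  have L: "ln (r / T) = ln r - ln T" "ln (D / T) = ln D - ln T" "ln (A / T) = ln A - ln T"
    "ln (T / D) = ln T - ln D" using r(1) A D T by (auto simp: ln_div)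
  \<comment> \<open>This is \<open>T\<close> times the entropy of the split of \<open>T\<close> into
    \<open>r\<close> and \<open>D\<close>, hence at least \<open>2 r D / T\<close> by
    \<open>ln x <= x - 1\<close>.\<close>
  have "xlnx t - xlnx (t - d) - xlnx d = - (r * ln (r / T)) - D * ln (D / T)"
    unfolding X L unfolding r(2) by (simp add: algebra_simps)
  moreover have "r * ln (r / T) \<le> r * (r / T - 1)" "D * ln (D / T) \<le> D * (D / T - 1)"
    using r D T by (auto intro!: mult_left_mono ln_le_minus_one)
  moreover have "r / T - 1 = - D / T" "D / T - 1 = - r / T" using T(1) r(2) by (auto simp: field_simps)
  hence "r * (r / T - 1) + D * (D / T - 1) = - D * (2 * r / T)" by (simp only:) simp
  ultimately have "D * (2 * r / T) < D * (J / A)"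
    using small H3 by (simp flip: D_def)
  hence "2 * r / T < J / A" by (rule mult_left_less_imp_less) (use D in simp)
  hence rT: "r < J / 2 * (T / A)" using A T by (simp add: field_simps)
  also have "\<dots> \<le> J / 2 * 1" using A T J by (intro mult_left_mono) auto
  finally have rJ: "r < J / 2" by simp
  \<comment> \<open>From \<open>ln x <= x / e\<close> at \<open>x = A / T\<close>, and
    \<open>e >= 5/2\<close>.\<close>
  have lnA: "(T / A) * ln (A / T) \<le> 2 / 5"
  proof -
    have "exp 1 \<ge> (5 / 2 :: real)" using exp_lower_Taylor_quadratic[of 1] by simp
    have "ln (A / T / exp 1) \<le> A / T / exp 1 - 1" using A T by (intro ln_le_minus_one) auto
    moreover have "ln (A / T / exp 1) = ln (A / T) - 1" using A T by (subst ln_div) auto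
    ultimately have "ln (A / T) \<le> A / T / exp 1" by simp
    also have "\<dots> \<le> A / T / (5 / 2)" using A T \<open>exp 1 \<ge> 5 / 2\<close> by (intro divide_left_mono) auto
    finally have "(T / A) * ln (A / T) \<le> (T / A) * (A / T / (5 / 2))"
      using A T by (intro mult_left_mono) auto
    thus ?thesis using A T by simp
  qed
  have "ln (T / D) \<ge> 0" using r D by simp
  hence "0 \<le> D * ln (T / D)" using D by simp
  moreover have "xlnx d - xlnx t + r * ln A = r * ln (A / T) - D * ln (T / D)"
    unfolding X L unfolding r(2) by (simp add: algebra_simps)
  moreover have "r * ln (A / T) \<le> J / 2 * (T / A) * ln (A / T)"
    using rT A T by (intro mult_right_mono) auto
  ultimately have H1: "xlnx d - xlnx t + r * ln A \<le> J / 2 * ((T / A) * ln (A / T))" by simp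
  have "2 * ((A + 1) / A - 1) / ((A + 1) / A + 1) \<le> ln ((A + 1) / A)"
    using A by (intro ln_ge_twice_quotient) auto
  hence "(A + 1) * (2 * ((A + 1) / A - 1) / ((A + 1) / A + 1)) \<le> (A + 1) * ln ((A + 1) / A)"
    using A by (intro mult_left_mono) auto
  moreover have "(A + 1) / A - (A + 1) * (2 * ((A + 1) / A - 1) / ((A + 1) / A + 1)) = (A + 1) / (A * (2 * A + 1))"
    using A by (simp add: divide_simps) (simp add: algebra_simps power2_eq_square)
  ultimately have "(A + 1) / A - (A + 1) * ln ((A + 1) / A) \<le> (A + 1) / (A * (2 * A + 1))" by linarith
  moreover have "ln ((A + 1) / A) \<le> (A + 1) / A - 1" using A by (intro ln_le_minus_one) auto
  ultimately have "r * ((A + 1) / A - (A + 1) * ln ((A + 1) / A)) \<le> r * ((A + 1) / (A * (2 * A + 1)))"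
    using r by (intro mult_left_mono) auto
  also have "\<dots> \<le> J / 2 * ((A + 1) / (A * (2 * A + 1)))"
    using rJ A by (intro mult_right_mono) auto
  finally have H2: "r * ((A + 1) / A - (A + 1) * ln ((A + 1) / A)) \<le> J / 2 * ((A + 1) / (A * (2 * A + 1)))" .
  \<comment> \<open>The square is absorbed by the term \<open>- J * (r / A^2)\<close> of the
    expansion.\<close>
  have H4: "2 * r\<^sup>2 / A\<^sup>2 \<le> J * (r / A\<^sup>2)"
    using rJ r A by (simp add: divide_simps power2_eq_square mult_right_mono)
  have "J / 2 * D * (D - 1) / A\<^sup>2 \<ge> r * D * (D - 1) / A\<^sup>2"
    using rJ D by (intro divide_right_mono mult_right_mono) auto
  moreover have "J * (J - 1) / 2 * D * (D - 1) / A\<^sup>2 \<ge> 0" using J D by simp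
  moreover have "D * (J / A) - (J * (A + 1) - J / 2) * D * (D - 1) / A\<^sup>2 \<le> J / A"
  proof -
    have "(A + 1 / 2) * (D * (D - 1)) \<ge> A * (D * (D - 1))" using D by (intro mult_right_mono) auto
    moreover have "A * (D - 1)\<^sup>2 = A * (D * (D - 1)) - (D * A - A)"
      by (simp add: algebra_simps power2_eq_square)
    moreover have "A * (D - 1)\<^sup>2 \<ge> 0" using A by simp
    ultimately have "D * A - (A + 1 / 2) * (D * (D - 1)) - A \<le> 0" by linarith
    hence "J / A\<^sup>2 * (D * A - (A + 1 / 2) * (D * (D - 1)) - A) \<le> 0"
      using J by (intro mult_nonneg_nonpos) auto
    also have "J / A\<^sup>2 * (D * A - (A + 1 / 2) * (D * (D - 1)) - A)
      = D * (J / A) - (J * (A + 1) - J / 2) * D * (D - 1) / A\<^sup>2 - J / A"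
      using A by (simp add: divide_simps) (simp add: power2_eq_square algebra_simps)
    finally show ?thesis by simp
  qed
  ultimately have H5: "D * (J / A) - (J * (A + 1) + J * (J - 1) / 2 - r) * D * (D - 1) / A\<^sup>2 \<le> J / A"
    by (simp add: algebra_simps add_divide_distrib diff_divide_distrib)
  have H6: "J / 2 * ((T / A) * ln (A / T)) + J / 2 * ((A + 1) / (A * (2 * A + 1))) + J / A - J * ((A + 1) / (2 * A)) \<le> 0"
  \<comment> \<open>For \<open>a = 2\<close> the constant 2/5 from \<open>lnA\<close> is too large,
    but then \<open>T = A\<close> and the logarithm vanishes.\<close>
  proof (cases "a = 2")
    case True
    hence "A = 2" "T = 2" using T d t by (auto simp: A_def T_def)
    thus ?thesis using J by simp
  next
    case False
    hence A: "A \<ge> 3" using a by (simp add: A_def)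
    have "J / 2 * ((T / A) * ln (A / T)) \<le> J / 2 * (2 / 5)" using lnA J by (intro mult_left_mono) auto
    moreover have "J / 2 * (2 / 5) + J / 2 * ((A + 1) / (A * (2 * A + 1))) + J / A - J * ((A + 1) / (2 * A))
      = - (J / (2 * A * (2 * A + 1))) * (6 / 5 * A\<^sup>2 - 12 / 5 * A - 2)"
      using A by (simp add: divide_simps) (simp add: power2_eq_square algebra_simps)
    moreover have "3 * A \<le> A\<^sup>2" using A by (simp add: power2_eq_square)
    hence "6 / 5 * A\<^sup>2 - 12 / 5 * A - 2 \<ge> 0" using A by linarith
    hence "(J / (2 * A * (2 * A + 1))) * (6 / 5 * A\<^sup>2 - 12 / 5 * A - 2) \<ge> 0"
      using A J by (intro mult_nonneg_nonneg) auto
    ultimately show ?thesis by linarith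
  qed
  have arith: "x1 + x2 + x3 + x4 - v - x6 - x7 < 0"
    if "x1 \<le> p1" "x2 \<le> p2" "x4 < q" "x3 \<le> x6" "q - x7 \<le> u" "p1 + p2 + u - v \<le> 0"
    for x1 x2 x3 x4 x6 x7 p1 p2 q u v :: real using that by linarith
  have "removal_bound a j d t - extremal_energy (a + 1) t
    = (xlnx d - xlnx t + r * ln A) + r * ((A + 1) / A - (A + 1) * ln ((A + 1) / A)) + 2 * r\<^sup>2 / A\<^sup>2
      + D * (gap (a + j) - gap a) - J * ((A + 1) / (2 * A)) - J * (r / A\<^sup>2)
      - (J * (A + 1) + J * (J - 1) / 2 - r) * D * (D - 1) / A\<^sup>2"
    unfolding removal_bound_eq[OF a1 s_def] A_def[symmetric] D_def[symmetric] J_def[symmetric] s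
    by (simp add: algebra_simps flip: add_divide_distrib)
  also from H1 H2 H3 H4 H5 H6 have "\<dots> < 0" by (rule arith)
  finally have "removal_bound a j d t - extremal_energy (a + 1) t < 0" .
  thus ?thesis by simp
qed

subsection \<open>Energy of symmetric relations\<close>

text \<open>Edges become ordered pairs, so \<open>card R\<close> is twice the number of edges and a
  sum over \<open>R\<close> counts every edge in both directions.\<close>

definition graph_rel :: "'a set \<Rightarrow> 'a rel \<Rightarrow> bool" where
  "graph_rel V R \<longleftrightarrow> finite V \<and> R \<subseteq> V \<times> V \<and> sym R \<and> irrefl R"

abbreviation deg :: "'a rel \<Rightarrow> 'a \<Rightarrow> nat" where "deg R v \<equiv> card (R `` {v})"

definition energy :: "'a set \<Rightarrow> 'a rel \<Rightarrow> real" where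
  "energy V R = (\<Sum>v\<in>V. xlnx (deg R v))"

lemma graph_rel_symD: "graph_rel V R \<Longrightarrow> (x, y) \<in> R \<Longrightarrow> (y, x) \<in> R"
  by (auto simp: graph_rel_def dest: symD)

lemma graph_rel_neq: "graph_rel V R \<Longrightarrow> (x, y) \<in> R \<Longrightarrow> x \<noteq> y"
  by (auto simp: graph_rel_def irrefl_def)

lemma graph_rel_finite: "graph_rel V R \<Longrightarrow> finite R"
  by (auto simp: graph_rel_def intro: finite_subset)

lemma finite_neighbours: "graph_rel V R \<Longrightarrow> finite (R `` {v})"
  by (rule finite_Image[OF graph_rel_finite]) auto

lemma neighbours_subset: "graph_rel V R \<Longrightarrow> R `` {v} \<subseteq> V - {v}"
  by (auto simp: graph_rel_def irrefl_def)

lemma sum_over_rel: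
  assumes "graph_rel V R" shows "(\<Sum>p\<in>R. h p) = (\<Sum>u\<in>V. \<Sum>w\<in>R `` {u}. h (u, w))"
proof -
  have "R = Sigma V (\<lambda>u. R `` {u})" using assms by (auto simp: graph_rel_def)
  hence "(\<Sum>p\<in>R. h p) = (\<Sum>p\<in>Sigma V (\<lambda>u. R `` {u}). h p)" by simp
  also have "\<dots> = (\<Sum>u\<in>V. \<Sum>w\<in>R `` {u}. h (u, w))"
    using assms finite_neighbours[OF assms] by (subst sum.Sigma) (auto simp: graph_rel_def)
  finally show ?thesis .
qed

lemma sum_fst_over_rel:
  fixes h :: "'a \<Rightarrow> real"
  assumes "graph_rel V R" shows "(\<Sum>p\<in>R. h (fst p)) = (\<Sum>u\<in>V. real (deg R u) * h u)"
  by (simp add: sum_over_rel[OF assms])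

lemma sum_swap_over_rel:
  assumes "graph_rel V R" shows "(\<Sum>p\<in>R. h (snd p)) = (\<Sum>p\<in>R. h (fst p))"
  using assms by (intro sum.reindex_bij_witness[of _ prod.swap prod.swap]) (auto dest: graph_rel_symD)

lemma card_rel: assumes "graph_rel V R" shows "card R = (\<Sum>v\<in>V. deg R v)"
  using sum_over_rel[OF assms, of "\<lambda>_. 1::nat"] by simp

text \<open>Each \<open>ln (deg R u)\<close> occurs \<open>deg R u\<close> times with
  \<open>u\<close> as first component and, by symmetry, as often with \<open>u\<close> as second
  component.\<close>

lemma energy_eq_sum_rel:
  assumes R: "graph_rel V R"
  shows "energy V R = (\<Sum>p\<in>R. ln (real (deg R (fst p)) * real (deg R (snd p)))) / 2"
proof -
  have pos: "deg R (fst p) > 0" "deg R (snd p) > 0" if "p \<in> R" for p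
    using that graph_rel_symD[OF R, of "fst p" "snd p"] finite_neighbours[OF R]
    by (cases p; force simp: card_gt_0_iff)+
  have "(\<Sum>p\<in>R. ln (real (deg R (fst p)) * real (deg R (snd p))))
      = (\<Sum>p\<in>R. ln (real (deg R (fst p)))) + (\<Sum>p\<in>R. ln (real (deg R (snd p))))"
    unfolding sum.distrib[symmetric] using pos by (intro sum.cong refl ln_mult_pos) auto
  also have "\<dots> = 2 * (\<Sum>p\<in>R. ln (real (deg R (fst p))))"
    using sum_swap_over_rel[OF R, of "\<lambda>u. ln (real (deg R u))"] by simp
  also have "\<dots> = 2 * energy V R"
    by (simp add: sum_fst_over_rel[OF R, of "\<lambda>u. ln (real (deg R u))"] energy_def xlnx_def)
  finally show ?thesis by simp
qed

section \<open>Complete relations and the second Zagreb index\<close>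

definition off_diagonal :: "'a set \<Rightarrow> 'a rel" where
  "off_diagonal S = {(x, y). x \<in> S \<and> y \<in> S \<and> x \<noteq> y}"

lemma graph_rel_off_diagonal: "finite S \<Longrightarrow> graph_rel S (off_diagonal S)"
  by (auto simp: graph_rel_def off_diagonal_def sym_def irrefl_def)

lemma off_diagonal_neighbours: "v \<in> S \<Longrightarrow> off_diagonal S `` {v} = S - {v}"
  by (auto simp: off_diagonal_def)

lemma card_off_diagonal: "finite S \<Longrightarrow> card (off_diagonal S) = card S * (card S - 1)"
  by (simp add: card_rel[OF graph_rel_off_diagonal] off_diagonal_neighbours)

lemma graph_rel_subset_off_diagonal: "graph_rel V R \<Longrightarrow> R \<subseteq> off_diagonal V"
  by (auto simp: graph_rel_def off_diagonal_def irrefl_def)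

text \<open>Sum \<open>h p = d u * d w - (d u + d w) / 2\<close> over pairs
  \<open>p = (u, w)\<close>. All off-diagonal pairs give \<open>c^2 - Q - N c\<close>, and
  \<open>R\<close> gives the sum of degree products minus \<open>Q\<close>, so the sum of squares
  \<open>Q\<close> cancels. The difference is a sum over non-edges, each contributing at least
  \<open>\<delta> (\<delta> - 1)\<close>.\<close>

lemma sum_deg_products_le:
  fixes \<delta> :: real
  assumes R: "graph_rel S R" and \<delta>: "\<delta> \<ge> 1" "\<And>u. u \<in> S \<Longrightarrow> \<delta> \<le> deg R u" and N: "card S = Suc N"
  defines "c \<equiv> real (card R)"
  shows "(\<Sum>p\<in>R. real (deg R (fst p)) * real (deg R (snd p)))
           \<le> c\<^sup>2 - c * N - (real (Suc N) * N - c) * (\<delta> * (\<delta> - 1))"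
proof -
  have S: "finite S" using R by (simp add: graph_rel_def)
  define d where "d = (\<lambda>u. real (deg R u))"
  define h where "h = (\<lambda>p. d (fst p) * d (snd p) - (d (fst p) + d (snd p)) / 2)"
  define Q where "Q = (\<Sum>u\<in>S. (d u)\<^sup>2)"
  have c: "(\<Sum>u\<in>S. d u) = c" using card_rel[OF R] by (simp add: c_def d_def)
  note O = graph_rel_off_diagonal[OF S]
  have sub: "R \<subseteq> off_diagonal S" by (rule graph_rel_subset_off_diagonal[OF R])
  have fin: "finite (off_diagonal S)" by (rule graph_rel_finite[OF O])
  have half: "(\<Sum>p\<in>P. (d (fst p) + d (snd p)) / 2) = (\<Sum>u\<in>S. real (deg P u) * d u)" if P: "graph_rel S P" for P
    using sum_swap_over_rel[OF P, of d] sum_fst_over_rel[OF P, of d]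
    by (simp add: sum.distrib flip: sum_divide_distrib)
  have "(\<Sum>p\<in>off_diagonal S. d (fst p) * d (snd p)) = (\<Sum>u\<in>S. d u * (c - d u))"
    unfolding sum_over_rel[OF O] using S
    by (intro sum.cong refl) (simp add: off_diagonal_neighbours sum_distrib_left[symmetric] sum_diff1 c)
  also have "\<dots> = c\<^sup>2 - Q"
    by (simp add: algebra_simps sum_subtractf power2_eq_square Q_def sum_distrib_left[symmetric] c)
  finally have 1: "(\<Sum>p\<in>off_diagonal S. d (fst p) * d (snd p)) = c\<^sup>2 - Q" .
  have "(\<Sum>u\<in>S. real (deg (off_diagonal S) u) * d u) = (\<Sum>u\<in>S. N * d u)"
    using N S by (intro sum.cong refl) (simp add: off_diagonal_neighbours)
  also have "\<dots> = N * c" by (simp add: sum_distrib_left[symmetric] c)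
  finally have "(\<Sum>p\<in>off_diagonal S. h p) = c\<^sup>2 - Q - N * c"
    unfolding h_def sum_subtractf 1 half[OF O] by simp
  moreover have "(\<Sum>p\<in>R. h p) = (\<Sum>p\<in>R. d (fst p) * d (snd p)) - Q"
    unfolding h_def sum_subtractf half[OF R] Q_def by (simp add: d_def power2_eq_square)
  moreover have "(\<Sum>p\<in>off_diagonal S. h p) = (\<Sum>p\<in>off_diagonal S - R. h p) + (\<Sum>p\<in>R. h p)"
    using sum.subset_diff[OF sub fin] .
  moreover have "real (card (off_diagonal S - R)) * (\<delta> * (\<delta> - 1)) \<le> (\<Sum>p\<in>off_diagonal S - R. h p)"
  proof (rule sum_bounded_below)
    fix p assume "p \<in> off_diagonal S - R"
    hence "\<delta> \<le> d (fst p)" "\<delta> \<le> d (snd p)" using \<delta>(2) by (auto simp: off_diagonal_def d_def)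
    \<comment> \<open>\<open>h p\<close> is \<open>(d u - 1/2) (d w - 1/2) - 1/4\<close>.\<close>
    hence "(\<delta> - 1 / 2) * (\<delta> - 1 / 2) \<le> (d (fst p) - 1 / 2) * (d (snd p) - 1 / 2)"
      using \<delta>(1) by (intro mult_mono) auto
    thus "\<delta> * (\<delta> - 1) \<le> h p" by (simp add: h_def algebra_simps add_divide_distrib)
  qed
  moreover have "real (card (off_diagonal S - R)) = real (Suc N) * N - c"
    using card_Diff_subset[OF graph_rel_finite[OF R] sub] card_mono[OF fin sub] card_off_diagonal[OF S]
    by (simp add: N c_def of_nat_diff algebra_simps)
  ultimately show ?thesis unfolding d_def by (simp add: algebra_simps)
qed

text \<open>The tangent to \<open>ln\<close> at \<open>a\<^sup>2\<close> turns the energy into the second Zagreb index.\<close>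

lemma energy_le_of_min_degree:
  fixes \<delta> a :: real
  assumes R: "graph_rel S R" and \<delta>: "\<delta> \<ge> 1" "\<And>u. u \<in> S \<Longrightarrow> \<delta> \<le> deg R u" and N: "card S = Suc N"
    and a: "a > 0" and m: "real (card R) = 2 * m"
  shows "energy S R \<le> 2 * m * ln a - m
    + (2 * m\<^sup>2 - m * N - (real (Suc N) * N / 2 - m) * \<delta> * (\<delta> - 1)) / a\<^sup>2"
proof -
  let ?w = "\<lambda>p. real (deg R (fst p)) * real (deg R (snd p))"
  have "energy S R = (\<Sum>p\<in>R. ln (?w p)) / 2" by (rule energy_eq_sum_rel[OF R])
  also have "(\<Sum>p\<in>R. ln (?w p)) \<le> (\<Sum>p\<in>R. 2 * ln a + ?w p / a\<^sup>2 - 1)"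
  proof (rule sum_mono)
    fix p assume p: "p \<in> R"
    hence "fst p \<in> S" "snd p \<in> S" using R by (auto simp: graph_rel_def)
    hence w: "?w p > 0" using \<delta> by (force intro: mult_pos_pos)
    have "ln (?w p / a\<^sup>2) = ln (?w p) - ln (a\<^sup>2)" using w a by (intro ln_divide_pos) auto
    hence "ln (?w p) = ln (a\<^sup>2) + ln (?w p / a\<^sup>2)" by simp
    also have "\<dots> \<le> 2 * ln a + ?w p / a\<^sup>2 - 1"
      using w a ln_le_minus_one[of "?w p / a\<^sup>2"] by (simp add: ln_realpow)
    finally show "ln (?w p) \<le> 2 * ln a + ?w p / a\<^sup>2 - 1" .
  qed
  also have "\<dots> = 2 * m * (2 * ln a - 1) + (\<Sum>p\<in>R. ?w p) / a\<^sup>2"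
    by (simp add: sum.distrib sum_subtractf m sum_divide_distrib algebra_simps)
  also have "(\<Sum>p\<in>R. ?w p) / a\<^sup>2 \<le> ((2 * m)\<^sup>2 - 2 * m * N - (real (Suc N) * N - 2 * m) * (\<delta> * (\<delta> - 1))) / a\<^sup>2"
    using sum_deg_products_le[OF R \<delta> N] by (intro divide_right_mono) (auto simp: m)
  finally show ?thesis using a by (simp add: field_simps power2_eq_square)
qed

section \<open>Removal of a vertex and the structure of maximisers\<close>

lemma graph_rel_Domain: assumes "graph_rel V R" shows "graph_rel (Domain R) R"
  using assms graph_rel_symD[OF assms] finite_Domain[OF graph_rel_finite[OF assms]]
  by (auto simp: graph_rel_def)

lemma energy_subset:
  assumes "finite V" "S \<subseteq> V" "Domain R \<subseteq> S" shows "energy V R = energy S R"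
  unfolding energy_def
proof (rule sum.mono_neutral_right[OF assms(1,2)])
  have "R `` {i} = {}" if "i \<notin> S" for i using that assms(3) by blast
  thus "\<forall>i\<in>V - S. xlnx (deg R i) = 0" by simp
qed

text \<open>Only pairs are deleted: over the same vertex set, \<open>v\<close> becomes isolated and
  contributes no energy.\<close>

definition remove_vertex :: "'a rel \<Rightarrow> 'a \<Rightarrow> 'a rel" where
  "remove_vertex R v = {(x, y) \<in> R. x \<noteq> v \<and> y \<noteq> v}"

lemma graph_rel_remove_vertex:
  "graph_rel V R \<Longrightarrow> graph_rel (V - {v}) (remove_vertex R v)"
  by (auto simp: graph_rel_def remove_vertex_def sym_def irrefl_def)

lemma graph_rel_mono: "graph_rel S R \<Longrightarrow> S \<subseteq> V \<Longrightarrow> finite V \<Longrightarrow> graph_rel V R"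
  by (auto simp: graph_rel_def)

lemma deg_remove_vertex:
  assumes R: "graph_rel V R"
  shows "deg (remove_vertex R v) u = (if u = v then 0 else if u \<in> R `` {v} then deg R u - 1 else deg R u)"
proof -
  have "remove_vertex R v `` {u} = (if u = v then {} else R `` {u} - {v})"
    by (auto simp: remove_vertex_def)
  moreover have "v \<in> R `` {u} \<longleftrightarrow> u \<in> R `` {v}" using graph_rel_symD[OF R] by auto
  ultimately show ?thesis using finite_neighbours[OF R, of u] by (auto simp: card_Diff_singleton)
qed

lemma card_remove_vertex:
  assumes R: "graph_rel V R" shows "card R = card (remove_vertex R v) + 2 * deg R v"
proof -
  let ?D = "R `` {v}"
  have D: "finite ?D" by (rule finite_neighbours[OF R])
  have "R = remove_vertex R v \<union> ({v} \<times> ?D \<union> ?D \<times> {v})"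
    using graph_rel_symD[OF R] by (auto simp: remove_vertex_def)
  hence "card R = card (remove_vertex R v \<union> ({v} \<times> ?D \<union> ?D \<times> {v}))" by simp
  also have "\<dots> = card (remove_vertex R v) + card ({v} \<times> ?D \<union> ?D \<times> {v})"
    using D graph_rel_finite[OF graph_rel_remove_vertex[OF R]]
    by (intro card_Un_disjoint) (auto simp: remove_vertex_def)
  also have "card ({v} \<times> ?D \<union> ?D \<times> {v}) = 2 * deg R v"
    using D graph_rel_neq[OF R] by (subst card_Un_disjoint) (auto simp: card_cartesian_product)
  finally show ?thesis .
qed

text \<open>Only \<open>v\<close> and its neighbours change degree.\<close>

lemma energy_remove_vertex:
  assumes R: "graph_rel V R" and v: "v \<in> V"
  shows "energy V R = energy V (remove_vertex R v) + xlnx (deg R v)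
    + (\<Sum>u\<in>R `` {v}. xlnx (deg R u) - xlnx (deg R u - 1))"
proof -
  let ?h = "\<lambda>u. xlnx (deg R u) - xlnx (deg (remove_vertex R v) u)"
  have fin: "finite V" using R by (simp add: graph_rel_def)
  have sub: "insert v (R `` {v}) \<subseteq> V" using neighbours_subset[OF R] v by auto
  have "energy V R - energy V (remove_vertex R v) = (\<Sum>u\<in>V. ?h u)" by (simp add: energy_def sum_subtractf)
  also have "\<dots> = (\<Sum>u\<in>insert v (R `` {v}). ?h u)"
    using fin sub by (rule sum.mono_neutral_right) (simp add: deg_remove_vertex[OF R])
  also have "\<dots> = ?h v + (\<Sum>u\<in>R `` {v}. ?h u)"
    using neighbours_subset[OF R] finite_neighbours[OF R] by (intro sum.insert) auto
  also have "(\<Sum>u\<in>R `` {v}. ?h u) = (\<Sum>u\<in>R `` {v}. xlnx (deg R u) - xlnx (deg R u - 1))"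
    using graph_rel_neq[OF R] by (intro sum.cong refl) (auto simp: deg_remove_vertex[OF R])
  finally show ?thesis by (simp add: deg_remove_vertex[OF R])
qed

text \<open>Otherwise moving the edge \<open>uv\<close> to \<open>ux\<close> would increase the energy, by convexity.\<close>

lemma maximal_neighbour_of_min_degree:
  assumes R: "graph_rel V R"
    and max: "\<And>R'. graph_rel V R' \<Longrightarrow> card R' = card R \<Longrightarrow> energy V R' \<le> energy V R"
    and min: "\<And>x. x \<in> Domain R \<Longrightarrow> deg R v \<le> deg R x"
    and uv: "(u, v) \<in> R" and x: "x \<in> Domain R" "x \<noteq> u"
  shows "(u, x) \<in> R"
proof (rule ccontr)
  assume ux: "(u, x) \<notin> R"
  define R' where "R' = insert (u, x) (insert (x, u) (R - {(u, v), (v, u)}))"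
  have V: "finite V" "u \<in> V" "v \<in> V" "x \<in> V" using R uv x by (auto simp: graph_rel_def)
  have vu: "(v, u) \<in> R" "u \<noteq> v" using graph_rel_symD[OF R uv] graph_rel_neq[OF R uv] by auto
  have xv: "x \<noteq> v" using ux uv by auto
  have xu: "(x, u) \<notin> R" using ux graph_rel_symD[OF R] by auto
  have fin: "finite R" by (rule graph_rel_finite[OF R])
  have R': "graph_rel V R'"
    using R V x(2) by (auto simp: graph_rel_def R'_def sym_def irrefl_def)
  have "card {(u, v), (v, u)} = 2" using vu by simp
  hence "card (R - {(u, v), (v, u)}) = card R - 2" "card R \<ge> 2"
    using uv vu fin card_mono[OF fin, of "{(u, v), (v, u)}"] by (auto simp: card_Diff_subset)
  hence "card R' = card R" unfolding R'_def using fin ux xu x(2) by simp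
  hence le: "energy V R' \<le> energy V R" by (rule max[OF R'])
  note nb = finite_neighbours[OF R]
  have "R' `` {v} = R `` {v} - {u}" using xv vu by (auto simp: R'_def)
  hence dv: "deg R' v = deg R v - 1" using vu nb by (simp add: card_Diff_singleton)
  have "R' `` {x} = insert u (R `` {x})" using xv x(2) by (auto simp: R'_def)
  hence dx: "deg R' x = Suc (deg R x)" using xu nb by simp
  have other: "deg R' y = deg R y" if "y \<noteq> v" "y \<noteq> x" for y
  proof (cases "y = u")
    case True
    have "R' `` {u} = insert x (R `` {u} - {v})" using vu x(2) by (auto simp: R'_def)
    moreover have "v \<in> R `` {u}" "x \<notin> R `` {u}" using uv ux by auto
    ultimately show ?thesis using nb[of u] True
      by (metis Diff_iff card_Suc_Diff1 card_insert_disjoint finite_Diff)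
  next
    case False
    hence "R' `` {y} = R `` {y}" using that by (auto simp: R'_def)
    thus ?thesis by simp
  qed
  have "energy V R' - energy V R = (\<Sum>y\<in>V. xlnx (deg R' y) - xlnx (deg R y))"
    by (simp add: energy_def sum_subtractf)
  also have "\<dots> = (\<Sum>y\<in>{v, x}. xlnx (deg R' y) - xlnx (deg R y))"
    using V other by (intro sum.mono_neutral_right) auto
  also have "\<dots> = gap (deg R x) - gap (deg R v - 1)"
  proof -
    have "deg R v > 0" using vu nb[of v] by (auto simp: card_gt_0_iff)
    thus ?thesis using xv dv dx by (simp add: gap_def)
  qed
  also have "\<dots> > 0"
  proof -
    have "deg R v - 1 < deg R x" using min[OF x(1)] vu nb[of v] card_gt_0_iff[of "R `` {v}"] by auto
    thus ?thesis using strict_monoD[OF gap_strict_mono] by simp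
  qed
  finally show False using le by simp
qed

text \<open>For \<open>t = 0\<close> the value of \<open>w\<close> is irrelevant and may lie in \<open>K\<close>, since \<open>K = V\<close> is possible.\<close>

definition quasi_complete :: "'a set \<Rightarrow> nat \<Rightarrow> nat \<Rightarrow> 'a rel \<Rightarrow> bool" where
  "quasi_complete V k t R \<longleftrightarrow> (\<exists>K T w. K \<subseteq> V \<and> card K = k \<and> T \<subseteq> K \<and> card T = t
     \<and> (t = 0 \<or> w \<in> V - K) \<and> R = off_diagonal K \<union> T \<times> {w} \<union> {w} \<times> T)"

lemma energy_off_diagonal:
  assumes "finite V" "K \<subseteq> V" shows "energy V (off_diagonal K) = real (card K) * xlnx (card K - 1)"
proof -
  have K: "finite K" using assms finite_subset by blast
  have "energy V (off_diagonal K) = energy K (off_diagonal K)"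
    using assms by (intro energy_subset) (auto simp: off_diagonal_def)
  thus ?thesis using K by (simp add: energy_def off_diagonal_neighbours)
qed

text \<open>Removing \<open>w\<close> leaves the clique \<open>K\<close> and lowers its
  \<open>t\<close> neighbours from degree \<open>k\<close> to \<open>k - 1\<close>.\<close>

lemma energy_quasi_complete:
  assumes V: "finite V" and q: "quasi_complete V k t R" shows "energy V R = extremal_energy k t"
proof -
  from q obtain K T w where K: "K \<subseteq> V" "card K = k" and T: "T \<subseteq> K" "card T = t" and w: "t = 0 \<or> w \<in> V - K"
    and R: "R = off_diagonal K \<union> T \<times> {w} \<union> {w} \<times> T"
    unfolding quasi_complete_def by blast
  have fin: "finite K" "finite T"
    using finite_subset[OF K(1) V] finite_subset[OF T(1) finite_subset[OF K(1) V]] .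
  show ?thesis
  proof (cases "t = 0")
    case True
    hence "T = {}" using T fin by simp
    thus ?thesis using True energy_off_diagonal[OF V K(1)] by (simp add: R K(2) extremal_energy_def)
  next
    case False
    hence w: "w \<in> V" "w \<notin> K" using w by auto
    have "K \<noteq> {}" using False T fin by auto
    hence k: "k > 0" using K fin by auto
    have gr: "graph_rel V R" using V K T w unfolding R
      by (auto simp: graph_rel_def off_diagonal_def sym_def irrefl_def)
    have nw: "R `` {w} = T" using w T by (auto simp: R off_diagonal_def)
    have "remove_vertex R w = off_diagonal K"
      using w T by (auto simp: R remove_vertex_def off_diagonal_def)
    moreover have "deg R u = k" if "u \<in> T" for u
    proof -
      have "R `` {u} = insert w (K - {u})" using that w T by (auto simp: R off_diagonal_def)
      moreover have "u \<in> K" using that T by auto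
      ultimately show ?thesis using fin w K k by (simp add: card_Diff_singleton)
    qed
    ultimately have "energy V R = real k * xlnx (k - 1) + xlnx t + (\<Sum>u\<in>T. xlnx k - xlnx (k - 1))"
      using energy_remove_vertex[OF gr w(1)] energy_off_diagonal[OF V K(1)] by (simp add: nw T K)
    thus ?thesis using k T by (simp add: extremal_energy_def gap_def)
  qed
qed

section \<open>The induction on the number of edges\<close>

text \<open>The induction step for a maximiser, by the number \<open>N\<close> of its non-isolated
  vertices. The assumption \<open>IH\<close> is not strict; strictness comes from comparing the
  bounds after removal of \<open>v\<close>.\<close>

lemma maximal_dichotomy:
  assumes R: "graph_rel V R" and card_R: "card R = k * (k - 1) + 2 * t" and tk: "t < k" and k: "2 \<le> k"
    and max: "\<And>R'. graph_rel V R' \<Longrightarrow> card R' = card R \<Longrightarrow> energy V R' \<le> energy V R"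
    and IH: "\<And>R' k' t'. graph_rel V R' \<Longrightarrow> card R' < card R \<Longrightarrow> card R' = k' * (k' - 1) + 2 * t' \<Longrightarrow> t' < k'
      \<Longrightarrow> energy V R' \<le> extremal_energy k' t'"
  shows "quasi_complete V k t R \<or> energy V R < extremal_energy k t"
proof -
  define S where "S = Domain R"
  define N where "N = card S"
  have RS: "graph_rel S R" unfolding S_def by (rule graph_rel_Domain[OF R])
  have V: "finite V" and SV: "S \<subseteq> V" using R by (auto simp: graph_rel_def S_def)
  have S: "finite S" using finite_subset[OF SV V] .
  note nb = finite_neighbours[OF R]
  obtain a where a: "k = Suc a" "1 \<le> a" using k by (cases k) auto
  have c: "card R = (a + 1) * a + 2 * t" using card_R by (simp add: a)
  have "R \<noteq> {}" using c a by auto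
  hence "S \<noteq> {}" by (auto simp: S_def)
  then obtain v where v: "v \<in> S" and min: "\<And>x. x \<in> S \<Longrightarrow> deg R v \<le> deg R x"
    using ex_is_arg_min_if_finite[OF S, of "deg R"] by (auto simp: is_arg_min_linorder)
  define D where "D = R `` {v}"
  define d where "d = card D"
  have D: "D \<subseteq> S - {v}" "finite D" using neighbours_subset[OF RS] nb by (auto simp: D_def)
  have "D \<noteq> {}" using v by (auto simp: S_def D_def)
  hence d1: "1 \<le> d" using D by (simp add: d_def Suc_le_eq card_gt_0_iff)
  have dN: "d \<le> N - 1" using card_mono[OF _ D(1)] S v by (simp add: d_def N_def)
  have N2: "2 \<le> N" using d1 dN by linarith
  have dominating: "R `` {u} = S - {u}" if "u \<in> D" for u
  proof -
    have "(u, v) \<in> R" using that graph_rel_symD[OF R] by (auto simp: D_def)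
    hence "(u, x) \<in> R" if "x \<in> S" "x \<noteq> u" for x
      using maximal_neighbour_of_min_degree[OF R max, of v u x] min that by (auto simp: S_def)
    thus ?thesis using neighbours_subset[OF RS, of u] by auto
  qed
  have deg_D: "deg R u = N - 1" if "u \<in> D" for u using dominating[OF that] that D S by (auto simp: N_def)
  have card_le: "card R \<le> N * (N - 1)"
    using card_mono[OF graph_rel_finite[OF graph_rel_off_diagonal[OF S]] graph_rel_subset_off_diagonal[OF RS]]
    by (simp add: card_off_diagonal[OF S] N_def)
  \<comment> \<open>The \<open>d\<close> neighbours of \<open>v\<close> have degree
    \<open>N - 1\<close>, the other \<open>N - d\<close> non-isolated vertices at least
    \<open>d\<close>.\<close>
  have size: "d * (N - 1) + (N - d) * d \<le> card R"
  proof -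
    have "card R = (\<Sum>u\<in>S - D. deg R u) + (\<Sum>u\<in>D. deg R u)"
      unfolding card_rel[OF RS] using D S by (intro sum.subset_diff) auto
    moreover have "(\<Sum>u\<in>D. deg R u) = d * (N - 1)" by (simp add: deg_D d_def)
    moreover have "card (S - D) * d \<le> (\<Sum>u\<in>S - D. deg R u)"
      using sum_bounded_below[of "S - D" d "deg R"] min by (simp add: d_def D_def)
    moreover have "card (S - D) = N - d" using D S by (subst card_Diff_subset) (auto simp: N_def d_def)
    ultimately show ?thesis by simp
  qed
  define R' where "R' = remove_vertex R v"
  have cR': "card R = card R' + 2 * d" using card_remove_vertex[OF R, of v] by (simp add: R'_def d_def D_def)
  have RS': "graph_rel (S - {v}) R'" unfolding R'_def by (rule graph_rel_remove_vertex[OF RS])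
  have RV': "graph_rel V R'" using graph_rel_mono[OF RS'] SV V by auto
  have cS': "card (S - {v}) = N - 1" using v S by (simp add: N_def)
  have "energy V R = energy V R' + xlnx d + (\<Sum>u\<in>D. xlnx (deg R u) - xlnx (deg R u - 1))"
    using energy_remove_vertex[OF R, of v] v SV by (auto simp: R'_def d_def D_def)
  also have "(\<Sum>u\<in>D. xlnx (deg R u) - xlnx (deg R u - 1)) = real d * gap (N - 2)"
  proof -
    have "Suc (N - 2) = N - 1" using N2 by simp
    thus ?thesis by (simp add: deg_D gap_def d_def numeral_2_eq_2)
  qed
  finally have energy: "energy V R = energy V R' + xlnx d + real d * gap (N - 2)" .
  have full: "P = off_diagonal X" if "graph_rel X P" "card P = card X * (card X - 1)" for P X
    using that by (intro card_subset_eq graph_rel_subset_off_diagonal graph_rel_finite[OF graph_rel_off_diagonal])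
      (auto simp: card_off_diagonal graph_rel_def)
  have "k \<le> N"
  proof (rule ccontr)
    assume "\<not> k \<le> N"
    hence "N \<le> a" by (simp add: a)
    hence "N * (N - 1) \<le> a * a" by (intro mult_le_mono) auto
    also have "\<dots> < (a + 1) * a" using a by simp
    finally show False using card_le c by simp
  qed
  then consider "N = k" | "N = k + 1" | j where "N = k + 1 + j" "1 \<le> j"
    by (metis Suc_eq_plus1 Suc_leI le_add_diff_inverse le_eq_less_or_eq less_one linorder_not_less zero_less_diff)
  thus ?thesis
  proof cases
    case 1
    hence "t = 0" using card_le card_R by simp
    moreover have "R = off_diagonal S"
      by (rule full[OF RS]) (use 1 \<open>t = 0\<close> card_R in \<open>simp add: N_def\<close>)
    ultimately have "quasi_complete V k t R"
      unfolding quasi_complete_def using SV 1 by (intro exI[of _ S] exI[of _ "{}"]) (auto simp: N_def)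
    thus ?thesis ..
  next
    case 2
    hence cK: "card (S - {v}) = k" using cS' by simp
    have cR'_le: "card R' \<le> k * (k - 1)"
      using card_mono[OF graph_rel_finite[OF graph_rel_off_diagonal] graph_rel_subset_off_diagonal[OF RS']] S
      by (simp add: card_off_diagonal cK)
    hence "t \<le> d" using cR' card_R by linarith
    then consider "t = d" | "t < d" by linarith
    thus ?thesis
    proof cases
      case 1
      have "R' = off_diagonal (S - {v})" by (rule full[OF RS']) (use cR' card_R 1 cK in simp)
      moreover have "R = R' \<union> D \<times> {v} \<union> {v} \<times> D"
        using graph_rel_symD[OF R] by (auto simp: R'_def remove_vertex_def D_def)
      ultimately have "R = off_diagonal (S - {v}) \<union> D \<times> {v} \<union> {v} \<times> D" by simp
      moreover have "S - {v} \<subseteq> V" "v \<in> V - (S - {v})" using SV v by auto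
      ultimately have "quasi_complete V k t R"
        unfolding quasi_complete_def using D 1 cK d_def by blast
      thus ?thesis ..
    next
      case 2
      note t = this
      have "d \<le> k" using dN \<open>N = k + 1\<close> by simp
      \<comment> \<open>The degree count excludes \<open>d = a\<close> and \<open>d = a + 1\<close>,
        as \<open>extremal_energy_remove\<close> requires.\<close>
      have "d * a + d + (a + 2 - d) * d \<le> (a + 1) * a + 2 * t"
        using size c \<open>N = k + 1\<close> by (simp add: a algebra_simps)
      moreover have "d * a + d + (a + 2 - d) * d > (a + 1) * a + 2 * t" if "d = a \<or> d = a + 1"
        using that t by auto
      ultimately have "d + 2 \<le> k" using \<open>d \<le> k\<close> a by linarith
      \<comment> \<open>A clique on \<open>a + 1\<close> vertices has \<open>a\<close> more edges
        than one on \<open>a\<close>. Adding \<open>t\<close> edges and removing \<open>d\<close>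
        thus leaves \<open>a - (d - t)\<close> edges beyond the smaller clique.\<close>
      have "energy V R' \<le> extremal_energy a (a - (d - t))"
      proof (rule IH[OF RV'])
        show "card R' < card R" using cR' d1 by simp
        show "a - (d - t) < a" using t a by simp
        obtain b where b: "a = Suc b" using a by (cases a) auto
        have "d \<le> b" using \<open>d + 2 \<le> k\<close> a b by simp
        then obtain e where e: "b = d + e" using le_Suc_ex by blast
        obtain s where s: "d = t + s" using t less_imp_add_positive by blast
        show "card R' = a * (a - 1) + 2 * (a - (d - t))"
          using cR' c by (simp add: b s e algebra_simps)
      qed
      hence "energy V R < extremal_energy k t"
        using extremal_energy_remove[OF t \<open>d + 2 \<le> k\<close>] energy \<open>N = k + 1\<close> a by simp
      thus ?thesis ..
    qed
  next
    case (3 j)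
    have N: "N = a + 2 + j" using 3 a by simp
    have "N * d \<le> card R" using sum_bounded_below[of S d "deg R"] min
      by (simp add: card_rel[OF RS] N_def d_def D_def)
    moreover have "(a + 3) * d \<le> N * d" using N 3 by (intro mult_le_mono1) simp
    moreover have "(a + 1) * a + 2 * t < (a + 3) * (a + 1)" using tk a by (simp add: algebra_simps)
    ultimately have "(a + 3) * d < (a + 3) * (a + 1)" using c by linarith
    hence da: "d \<le> a" by (simp only: mult_less_cancel1) simp
    have "real d * (real N - 1) + (real N - real d) * d \<le> real (card R)"
      using size dN N2 of_nat_mono[OF size, where 'a = real] by (simp add: of_nat_diff)
    hence size': "real d * (2 * real a + 3 + 2 * real j - real d) \<le> (real a + 1) * a + 2 * real t"
      by (simp add: c N algebra_simps)
    moreover have "real d * (2 * real a + 5 - real d) \<le> real d * (2 * real a + 3 + 2 * real j - real d)"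
      using 3 by (intro mult_left_mono) auto
    ultimately have size'': "real d * (2 * real a + 5 - real d) \<le> real a * (real a + 1) + 2 * real t"
      by (simp add: algebra_simps)
    have a2: "2 \<le> a"
    proof (rule ccontr)
      assume "\<not> 2 \<le> a"
      hence "a = 1" "d = 1" "t \<le> 1" using a da d1 tk by auto
      thus False using size'' by simp
    qed
    have "energy V R \<le> removal_bound a j d t"
    proof -
      define m where "m = (real a + 1) * real a / 2 + real t - real d"
      have "energy V R' = energy (S - {v}) R'"
        using RS' SV V by (intro energy_subset) (auto simp: graph_rel_def)
      also have "\<dots> \<le> 2 * m * ln (real a) - m
        + (2 * m\<^sup>2 - m * real (a + j) - (real (Suc (a + j)) * real (a + j) / 2 - m) * real d * (real d - 1)) / (real a)\<^sup>2"
      proof (rule energy_le_of_min_degree[OF RS'])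
        fix u assume u: "u \<in> S - {v}"
        \<comment> \<open>The minimum degree survives: neighbours of \<open>v\<close> drop only to
          \<open>N - 2 = a + j\<close>, which is at least \<open>d\<close>, and other degrees do not
          change.\<close>
        have "d \<le> deg R' u"
        proof (cases "u \<in> D")
          case True
          thus ?thesis using u deg_D[OF True] da N by (simp add: R'_def deg_remove_vertex[OF R] D_def)
        next
          case False
          thus ?thesis using u min[of u] by (simp add: R'_def deg_remove_vertex[OF R] D_def d_def)
        qed
        thus "real d \<le> real (deg R' u)" by simp
      next
        show "card (S - {v}) = Suc (a + j)" using cS' N by simp
        have "real ((a + 1) * a + 2 * t) = real (card R' + 2 * d)" using cR' c by simp
        thus "real (card R') = 2 * m" by (simp add: m_def field_simps)
      qed (use d1 a in auto)
      finally show ?thesis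
        unfolding removal_bound_def Let_def m_def[symmetric] energy by (simp add: N algebra_simps)
    qed
    \<comment> \<open>Failure of the removal bound means failure of \<open>small\<close>; then the
      inductive bound for \<open>t - d\<close> suffices, since \<open>extremal_energy k t\<close>
      exceeds it by \<open>d * gap a + xlnx t - xlnx (t - d)\<close>.\<close>
    moreover have "energy V R < extremal_energy k t" if "d < t" "\<not> removal_bound a j d t < extremal_energy k t"
    proof -
      have ta: "t \<le> a" using tk a by simp
      have "\<not> xlnx t - xlnx (t - d) - xlnx d \<le> real d * (gap (a + j) - gap a)"
        using removal_bound_less_lt[OF a2 3(2) d1 that(1) ta] that(2) a by auto
      moreover have "energy V R' \<le> extremal_energy k (t - d)"
        by (rule IH[OF RV']) (use cR' card_R d1 tk that(1) in auto)
      moreover have "gap (N - 2) = gap (a + j)" by (simp add: N)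
      ultimately show ?thesis unfolding energy
        using that(1) a by (simp add: extremal_energy_def of_nat_diff algebra_simps)
    qed
    moreover have "removal_bound a j d t < extremal_energy k t" if "\<not> d < t"
      using removal_bound_less_ge[OF a2 3(2) d1 da _ size''] that a by simp
    ultimately show ?thesis by fastforce
  qed
qed

lemma obtain_maximal:
  assumes R: "graph_rel V R"
  obtains Q where "graph_rel V Q" "card Q = card R" "energy V R \<le> energy V Q"
    "\<And>R'. graph_rel V R' \<Longrightarrow> card R' = card Q \<Longrightarrow> energy V R' \<le> energy V Q"
proof -
  let ?G = "{P. graph_rel V P \<and> card P = card R}"
  have "finite ?G"
    using R by (intro finite_subset[of ?G "Pow (V \<times> V)"]) (auto simp: graph_rel_def)
  moreover have "R \<in> ?G" using R by simp
  ultimately have "Max (energy V ` ?G) \<in> energy V ` ?G" "\<And>P. P \<in> ?G \<Longrightarrow> energy V P \<le> Max (energy V ` ?G)"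
    by (auto intro!: Max_in Max_ge)
  thus ?thesis using that \<open>R \<in> ?G\<close> by (smt (verit) imageE mem_Collect_eq)
qed

text \<open>\<open>R\<close> is replaced by a maximiser with as many pairs, to which the dichotomy
  applies. The remaining case \<open>k = 1\<close> is the empty relation.\<close>

lemma energy_le:
  assumes "graph_rel V R" "card R = k * (k - 1) + 2 * t" "t < k"
  shows "energy V R \<le> extremal_energy k t"
  using assms
proof (induction "card R" arbitrary: R k t rule: less_induct)
  case less
  have V: "finite V" using less.prems by (simp add: graph_rel_def)
  show ?case
  proof (cases "2 \<le> k")
    case True
    obtain Q where Q: "graph_rel V Q" "card Q = card R" "energy V R \<le> energy V Q"
      "\<And>R'. graph_rel V R' \<Longrightarrow> card R' = card Q \<Longrightarrow> energy V R' \<le> energy V Q"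
      using obtain_maximal[OF less.prems(1)] by blast
    have "quasi_complete V k t Q \<or> energy V Q < extremal_energy k t"
      using less Q True by (intro maximal_dichotomy) auto
    thus ?thesis using energy_quasi_complete[OF V] Q(3) by fastforce
  next
    case False
    hence "k = 1" "t = 0" using less.prems by auto
    hence "R = {}" using less.prems graph_rel_finite[OF less.prems(1)] by simp
    thus ?thesis using \<open>k = 1\<close> \<open>t = 0\<close> by (simp add: energy_def extremal_energy_def)
  qed
qed

text \<open>A relation that attains the bound is a maximiser by \<open>energy_le\<close>, so the
  dichotomy applies to it directly.\<close>

lemma energy_eq_iff:
  assumes "graph_rel V R" "card R = k * (k - 1) + 2 * t" "t < k" "2 \<le> k"
  shows "energy V R = extremal_energy k t \<longleftrightarrow> quasi_complete V k t R"
proof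
  assume eq: "energy V R = extremal_energy k t"
  have "quasi_complete V k t R \<or> energy V R < extremal_energy k t"
    using assms energy_le eq by (intro maximal_dichotomy) auto
  thus "quasi_complete V k t R" using eq by simp
qed (use assms energy_quasi_complete in \<open>auto simp: graph_rel_def\<close>)

subsection \<open>Isomorphism with the extremal graph\<close>

text \<open>The set \<open>W\<close>, empty or a singleton according to \<open>sigma t\<close>,
  replaces the vertex \<open>w\<close> and makes the cases \<open>t = 0\<close> and
  \<open>t > 0\<close> uniform.\<close>

lemma quasi_complete_iff:
  assumes V: "finite V"
  shows "quasi_complete V k t R \<longleftrightarrow> (\<exists>K T W. K \<subseteq> V \<and> card K = k \<and> T \<subseteq> K \<and> card T = t
     \<and> W \<subseteq> V - K \<and> card W = sigma t \<and> R = off_diagonal K \<union> T \<times> W \<union> W \<times> T)" (is "?l \<longleftrightarrow> ?r")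
proof
  assume ?l
  then obtain K T w where K: "K \<subseteq> V" "card K = k" and T: "T \<subseteq> K" "card T = t" and w: "t = 0 \<or> w \<in> V - K"
    and R: "R = off_diagonal K \<union> T \<times> {w} \<union> {w} \<times> T"
    unfolding quasi_complete_def by blast
  have "finite T" by (rule finite_subset[OF T(1) finite_subset[OF K(1) V]])
  hence "t = 0 \<Longrightarrow> T = {}" using T by simp
  thus ?r using K T w R
    by (intro exI[of _ K] exI[of _ T] exI[of _ "if t = 0 then {} else {w}"]) (auto simp: sigma_def)
next
  assume ?r
  then obtain K T W where K: "K \<subseteq> V" "card K = k" and T: "T \<subseteq> K" "card T = t"
    and W: "W \<subseteq> V - K" "card W = sigma t" and R: "R = off_diagonal K \<union> T \<times> W \<union> W \<times> T"
    by blast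
  have fin: "finite T" by (rule finite_subset[OF T(1) finite_subset[OF K(1) V]])
  show ?l
  proof (cases "t = 0")
    case True
    hence "T = {}" using T fin by simp
    thus ?thesis using True K R unfolding quasi_complete_def by (intro exI[of _ K] exI[of _ T]) simp
  next
    case False
    then obtain w where "W = {w}" using W by (auto simp: sigma_def card_1_singleton_iff)
    thus ?thesis using K T W R unfolding quasi_complete_def
      by (intro exI[of _ K] exI[of _ T] exI[of _ w]) simp
  qed
qed

lemma bij_betw_extend:
  assumes f: "bij_betw f A B" and fin: "finite V" "finite V'" and sub: "A \<subseteq> V" "B \<subseteq> V'" and card: "card V = card V'"
  obtains g where "bij_betw g V V'" "\<And>x. x \<in> A \<Longrightarrow> g x = f x"
proof -
  have "finite A" "finite B" using fin sub finite_subset by auto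
  hence "card (V - A) = card (V' - B)"
    using bij_betw_same_card[OF f] sub card by (simp add: card_Diff_subset)
  then obtain h where h: "bij_betw h (V - A) (V' - B)"
    using finite_same_card_bij[of "V - A" "V' - B"] fin by auto
  have "bij_betw (\<lambda>x. if x \<in> A then f x else h x) (A \<union> (V - A)) (B \<union> (V' - B))"
    by (rule bij_betw_disjoint_Un[OF f h]) auto
  moreover have "A \<union> (V - A) = V" "B \<union> (V' - B) = V'" using sub by auto
  ultimately show ?thesis using that[of "\<lambda>x. if x \<in> A then f x else h x"] by simp
qed

text \<open>A bijection is extended along \<open>T\<close>, \<open>K\<close>,
  \<open>K \<union> W\<close>, \<open>V\<close>. Membership in the first three sets, together with
  equality of vertices, determines the relation.\<close>

lemma quasi_complete_isomorphic:
  assumes V: "finite V" "finite V'" "card V = card V'"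
    and q: "quasi_complete V k t R" "quasi_complete V' k t R'"
  obtains f where "bij_betw f V V'" "\<And>u v. u \<in> V \<Longrightarrow> v \<in> V \<Longrightarrow> (u, v) \<in> R \<longleftrightarrow> (f u, f v) \<in> R'"
proof -
  from q(1) obtain K T W where K: "K \<subseteq> V" "card K = k" and T: "T \<subseteq> K" "card T = t"
    and W: "W \<subseteq> V - K" "card W = sigma t" and R: "R = off_diagonal K \<union> T \<times> W \<union> W \<times> T"
    unfolding quasi_complete_iff[OF V(1)] by blast
  from q(2) obtain K' T' W' where K': "K' \<subseteq> V'" "card K' = k" and T': "T' \<subseteq> K'" "card T' = t"
    and W': "W' \<subseteq> V' - K'" "card W' = sigma t" and R': "R' = off_diagonal K' \<union> T' \<times> W' \<union> W' \<times> T'"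
    unfolding quasi_complete_iff[OF V(2)] by blast
  have TV: "T \<subseteq> V" "T' \<subseteq> V'" "W \<subseteq> V" "W' \<subseteq> V'" using T T' K K' W W' by auto
  have fin: "finite K" "finite K'" "finite T" "finite T'" "finite W" "finite W'"
    using finite_subset[OF _ V(1)] finite_subset[OF _ V(2)] K(1) K'(1) TV by blast+
  have KW: "K \<inter> W = {}" "K' \<inter> W' = {}" using W W' by auto
  obtain f1 where f1: "bij_betw f1 T T'" using finite_same_card_bij[of T T'] fin T T' by auto
  obtain f2 where f2: "bij_betw f2 K K'" "\<And>x. x \<in> T \<Longrightarrow> f2 x = f1 x"
    using bij_betw_extend[OF f1 fin(1,2) T(1) T'(1)] K K' by auto
  obtain f3 where f3: "bij_betw f3 (K \<union> W) (K' \<union> W')" "\<And>x. x \<in> K \<Longrightarrow> f3 x = f2 x"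
    using bij_betw_extend[OF f2(1), of "K \<union> W" "K' \<union> W'"] fin K K' W W' KW
    by (auto simp: card_Un_disjoint)
  obtain f where f: "bij_betw f V V'" "\<And>x. x \<in> K \<union> W \<Longrightarrow> f x = f3 x"
    using bij_betw_extend[OF f3(1) V(1,2)] V(3) K K' TV by auto
  have inj: "inj_on f V" using f(1) by (simp add: bij_betw_def)
  have "f ` T = f1 ` T" "f ` K = f2 ` K" "f ` (K \<union> W) = f3 ` (K \<union> W)"
    using f(2) f3(2) f2(2) T(1) by (auto intro!: image_cong)
  hence img: "f ` T = T'" "f ` K = K'" "f ` (K \<union> W) = K' \<union> W'"
    using f1 f2(1) f3(1) by (simp_all add: bij_betw_def)
  have mem: "f x \<in> T' \<longleftrightarrow> x \<in> T" "f x \<in> K' \<longleftrightarrow> x \<in> K" "f x \<in> K' \<union> W' \<longleftrightarrow> x \<in> K \<union> W" if "x \<in> V" for x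
    using inj_on_image_mem_iff[OF inj that, of T] inj_on_image_mem_iff[OF inj that, of K]
      inj_on_image_mem_iff[OF inj that, of "K \<union> W"] TV K(1) unfolding img by blast+
  have "(u, v) \<in> R \<longleftrightarrow> (f u, f v) \<in> R'" if "u \<in> V" "v \<in> V" for u v
  proof -
    have "f u = f v \<longleftrightarrow> u = v" using inj that by (auto simp: inj_on_def)
    thus ?thesis using mem[OF that(1)] mem[OF that(2)] KW unfolding R R' off_diagonal_def by blast
  qed
  thus ?thesis using that f(1) by blast
qed

text \<open>The witnesses are the preimages of \<open>K\<close>, \<open>T\<close> and
  \<open>W\<close> under \<open>f\<close>.\<close>

lemma quasi_complete_pullback:
  assumes V: "finite V" and f: "bij_betw f V V'" and R: "R \<subseteq> V \<times> V"
    and iso: "\<And>u v. u \<in> V \<Longrightarrow> v \<in> V \<Longrightarrow> (u, v) \<in> R \<longleftrightarrow> (f u, f v) \<in> R'"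
    and q: "quasi_complete V' k t R'"
  shows "quasi_complete V k t R"
proof -
  have V': "finite V'" using f V bij_betw_finite by blast
  from q obtain K T W where K: "K \<subseteq> V'" "card K = k" and T: "T \<subseteq> K" "card T = t"
    and W: "W \<subseteq> V' - K" "card W = sigma t" and R': "R' = off_diagonal K \<union> T \<times> W \<union> W \<times> T"
    unfolding quasi_complete_iff[OF V'] by blast
  define p where "p X = {x \<in> V. f x \<in> X}" for X
  have inj: "inj_on f V" and surj: "f ` V = V'" using f by (auto simp: bij_betw_def)
  have card: "card (p X) = card X" if "X \<subseteq> V'" for X
  proof -
    have "f ` p X = X" using that surj by (auto simp: p_def)
    moreover have "inj_on f (p X)" using inj by (rule inj_on_subset) (auto simp: p_def)
    ultimately show ?thesis using card_image by fastforce
  qed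
  have "R = off_diagonal (p K) \<union> p T \<times> p W \<union> p W \<times> p T"
  proof (intro set_eqI)
    fix e :: "'a \<times> 'a"
    obtain u v where e: "e = (u, v)" by fastforce
    show "e \<in> R \<longleftrightarrow> e \<in> off_diagonal (p K) \<union> p T \<times> p W \<union> p W \<times> p T"
    proof (cases "u \<in> V \<and> v \<in> V")
      case True
      moreover from True have "f u = f v \<longleftrightarrow> u = v" using inj by (auto simp: inj_on_def)
      ultimately show ?thesis using iso[of u v] by (simp add: e R' off_diagonal_def p_def)
    next
      case False
      thus ?thesis using R by (auto simp: e off_diagonal_def p_def)
    qed
  qed
  moreover have "p K \<subseteq> V" "p T \<subseteq> p K" "p W \<subseteq> V - p K" using T W by (auto simp: p_def)
  moreover have "T \<subseteq> V'" "W \<subseteq> V'" using T W K by auto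
  hence "card (p K) = k" "card (p T) = t" "card (p W) = sigma t" using card K T W by auto
  ultimately show ?thesis unfolding quasi_complete_iff[OF V] by blast
qed

section \<open>Translation between graphs and relations\<close>

definition rel_of :: "'a ugraph \<Rightarrow> 'a rel" where
  "rel_of G = {(u, v). {u, v} \<in> edges G}"

lemma graph_rel_rel_of: assumes "simple_graph G" shows "graph_rel (verts G) (rel_of G)"
proof -
  have *: "u \<in> verts G \<and> v \<in> verts G \<and> u \<noteq> v" if "{u, v} \<in> edges G" for u v
    using assms that by (force simp: simple_graph_def)
  show ?thesis using * assms
    by (auto simp: graph_rel_def rel_of_def sym_def irrefl_def simple_graph_def insert_commute)
qed

lemma deg_rel_of: assumes G: "simple_graph G" shows "deg (rel_of G) v = vertex_degree G v"
proof -
  have "bij_betw (\<lambda>u. {v, u}) (rel_of G `` {v}) {e \<in> edges G. v \<in> e}"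
    unfolding bij_betw_def
  proof (intro conjI)
    show "inj_on (\<lambda>u. {v, u}) (rel_of G `` {v})" by (auto simp: inj_on_def doubleton_eq_iff)
    show "(\<lambda>u. {v, u}) ` (rel_of G `` {v}) = {e \<in> edges G. v \<in> e}"
    proof (intro equalityI subsetI)
      fix e assume e: "e \<in> {e \<in> edges G. v \<in> e}"
      hence "card e = 2" using G by (simp add: simple_graph_def)
      then obtain u where "e = {v, u}" using e by (auto simp: card_2_iff)
      thus "e \<in> (\<lambda>u. {v, u}) ` (rel_of G `` {v})" using e by (auto simp: rel_of_def)
    qed (auto simp: rel_of_def)
  qed
  thus ?thesis unfolding vertex_degree_def by (rule bij_betw_same_card)
qed

lemma sum_vertex_degree:
  assumes G: "simple_graph G" shows "(\<Sum>v\<in>verts G. vertex_degree G v) = 2 * card (edges G)"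
  unfolding vertex_degree_def
proof (rule sum_multicount)
  show "finite (verts G)" using G by (simp add: simple_graph_def)
  thus "finite (edges G)"
    using G by (intro finite_subset[of "edges G" "Pow (verts G)"]) (auto simp: simple_graph_def)
  show "\<forall>e\<in>edges G. card {v \<in> verts G. v \<in> e} = 2"
  proof
    fix e assume "e \<in> edges G"
    moreover from this have "{v \<in> verts G. v \<in> e} = e" using G by (auto simp: simple_graph_def)
    ultimately show "card {v \<in> verts G. v \<in> e} = 2" using G by (simp add: simple_graph_def)
  qed
qed

lemma card_rel_of: "simple_graph G \<Longrightarrow> card (rel_of G) = 2 * card (edges G)"
  by (simp add: card_rel[OF graph_rel_rel_of] deg_rel_of sum_vertex_degree)

text \<open>Splitting the logarithm of each quotient yields the energy, and the fractions
  \<open>?d v / c\<close> sum to 1, which yields the term \<open>log 2 c\<close>.\<close>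

lemma degree_entropy_eq:
  assumes G: "simple_graph G" and m: "card (edges G) = m" "0 < m"
  shows "degree_entropy G = log 2 (2 * real m) - energy (verts G) (rel_of G) / ln 2 / (2 * real m)"
proof -
  let ?d = "\<lambda>v. real (vertex_degree G v)"
  define c where "c = 2 * real m"
  have c: "c > 0" using m by (simp add: c_def)
  have sum: "(\<Sum>v\<in>verts G. ?d v) = c"
    using sum_vertex_degree[OF G] m by (simp add: c_def flip: of_nat_sum)
  have "degree_entropy G = - (\<Sum>v\<in>verts G. ?d v / c * log 2 (?d v / c))"
    by (simp add: degree_entropy_def sum)
  also have "(\<Sum>v\<in>verts G. ?d v / c * log 2 (?d v / c))
    = (\<Sum>v\<in>verts G. xlnx (vertex_degree G v) / ln 2 / c - ?d v / c * log 2 c)"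
  proof (intro sum.cong refl)
    fix v
    show "?d v / c * log 2 (?d v / c) = xlnx (vertex_degree G v) / ln 2 / c - ?d v / c * log 2 c"
    \<comment> \<open>The logarithm of a quotient splits only for positive degree; for degree 0 both
      sides vanish.\<close>
    proof (cases "vertex_degree G v = 0")
      case False
      hence "log 2 (?d v / c) = ln (?d v) / ln 2 - log 2 c" using c by (simp add: log_def ln_div diff_divide_distrib)
      thus ?thesis by (simp add: xlnx_def right_diff_distrib)
    qed simp
  qed
  also have "\<dots> = (\<Sum>v\<in>verts G. xlnx (vertex_degree G v)) / ln 2 / c - (\<Sum>v\<in>verts G. ?d v) / c * log 2 c"
    by (simp add: sum_subtractf sum_divide_distrib sum_distrib_right)
  also have "\<dots> = energy (verts G) (rel_of G) / ln 2 / c - log 2 c"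
    using c by (simp add: sum energy_def deg_rel_of[OF G])
  finally show ?thesis by (simp add: c_def)
qed

text \<open>The witnesses are the left copies of \<open>{..<k}\<close>, \<open>{..<t}\<close> and
  \<open>?W\<close>. The right summand has no edges, so it only supplies isolated vertices.\<close>

lemma quasi_complete_model:
  fixes k t r :: nat
  assumes "t \<le> k"
  defines "H \<equiv> disjoint_union (K_ext k t) (complement_graph (complete_graph r))"
  shows "finite (verts H)" "card (verts H) = k + sigma t + r" "quasi_complete (verts H) k t (rel_of H)"
proof -
  let ?W = "if t = 0 then {} else {k}"
  have verts: "verts H = ({..<k} \<union> ?W) <+> {..<r}"
    by (auto simp: H_def disjoint_union_def K_ext_def complete_graph_def complement_graph_def)
  show fin: "finite (verts H)" by (simp add: verts)
  show "card (verts H) = k + sigma t + r" by (simp add: verts card_Plus sigma_def)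
  have edges: "edges H = (\<lambda>e. Inl ` e) ` edges (K_ext k t)"
    by (simp add: H_def disjoint_union_def complement_graph_def complete_graph_def)
  have K_edges: "{x, y} \<in> edges (K_ext k t)
      \<longleftrightarrow> (x, y) \<in> off_diagonal {..<k} \<union> {..<t} \<times> ?W \<union> ?W \<times> {..<t}" for x y
    using assms(1) by (auto simp: K_ext_def complete_graph_def off_diagonal_def doubleton_eq_iff card_2_iff)
  have "rel_of H = off_diagonal (Inl ` {..<k}) \<union> (Inl ` {..<t}) \<times> (Inl ` ?W) \<union> (Inl ` ?W) \<times> (Inl ` {..<t})"
  proof (intro set_eqI)
    fix p :: "(nat + nat) \<times> (nat + nat)"
    obtain u v where p: "p = (u, v)" by fastforce
    have "p \<in> rel_of H \<longleftrightarrow> (\<exists>x y. u = Inl x \<and> v = Inl y \<and> {x, y} \<in> edges (K_ext k t))"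
    proof
      assume "p \<in> rel_of H"
      then obtain e where e: "e \<in> edges (K_ext k t)" "{u, v} = Inl ` e" by (auto simp: p rel_of_def edges)
      then obtain x y where xy: "u = Inl x" "v = Inl y" by (metis imageE insertCI)
      hence "Inl ` {x, y} = (Inl ` e :: (nat + nat) set)" using e by simp
      hence "{x, y} = e" by (rule inj_image_eq_iff[THEN iffD1, rotated]) simp
      thus "\<exists>x y. u = Inl x \<and> v = Inl y \<and> {x, y} \<in> edges (K_ext k t)" using e xy by auto
    next
      assume "\<exists>x y. u = Inl x \<and> v = Inl y \<and> {x, y} \<in> edges (K_ext k t)"
      then obtain x y where xy: "{u, v} = Inl ` {x, y}" "{x, y} \<in> edges (K_ext k t)" by auto
      show "p \<in> rel_of H" using imageI[OF xy(2), of "image Inl"] xy(1) by (simp add: p rel_of_def edges)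
    qed
    thus "p \<in> rel_of H \<longleftrightarrow> p \<in> off_diagonal (Inl ` {..<k}) \<union> (Inl ` {..<t}) \<times> (Inl ` ?W) \<union> (Inl ` ?W) \<times> (Inl ` {..<t})"
      unfolding K_edges by (auto simp: p off_diagonal_def)
  qed
  moreover have "Inl ` {..<k} \<subseteq> verts H" "(Inl ` {..<t} :: (nat + nat) set) \<subseteq> Inl ` {..<k}"
    "Inl ` ?W \<subseteq> verts H - Inl ` {..<k}"
    using assms(1) by (auto simp: verts)
  moreover have "card (Inl ` {..<k} :: (nat + nat) set) = k" "card (Inl ` {..<t} :: (nat + nat) set) = t"
    "card (Inl ` ?W :: (nat + nat) set) = sigma t"
    by (simp_all add: card_image sigma_def)
  ultimately show "quasi_complete (verts H) k t (rel_of H)"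
    unfolding quasi_complete_iff[OF fin] by metis
qed

lemma graph_iso_quasi_complete_iff:
  assumes G: "simple_graph G" "card (verts G) = n" and tk: "t \<le> k"
  shows "graph_iso G (disjoint_union (K_ext k t) (complement_graph (complete_graph (n - k - sigma t))))
    \<longleftrightarrow> quasi_complete (verts G) k t (rel_of G)" (is "graph_iso G ?H \<longleftrightarrow> _")
proof
  have fin: "finite (verts G)" using G by (simp add: simple_graph_def)
  note H = quasi_complete_model[OF tk, of "n - k - sigma t"]
  {
    assume "graph_iso G ?H"
    then obtain f where f: "bij_betw f (verts G) (verts ?H)"
      "\<And>u v. u \<in> verts G \<Longrightarrow> v \<in> verts G \<Longrightarrow> {u, v} \<in> edges G \<longleftrightarrow> {f u, f v} \<in> edges ?H"
      unfolding graph_iso_def by blast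
    show "quasi_complete (verts G) k t (rel_of G)"
      using graph_rel_rel_of[OF G(1)] f(2) H(3)
      by (intro quasi_complete_pullback[OF fin f(1)]) (auto simp: graph_rel_def rel_of_def)
  }
  {
    assume q: "quasi_complete (verts G) k t (rel_of G)"
    then obtain K W where "K \<subseteq> verts G" "card K = k" "W \<subseteq> verts G - K" "card W = sigma t"
      unfolding quasi_complete_iff[OF fin] by blast
    moreover from this have "finite K" "finite W" using fin by (auto intro: finite_subset)
    moreover from calculation have "K \<inter> W = {}" by blast
    ultimately have "card (K \<union> W) = k + sigma t" "K \<union> W \<subseteq> verts G"
      by (simp add: card_Un_disjoint, blast)
    \<comment> \<open>This prevents the natural subtraction in \<open>n - k - sigma t\<close> from
      truncating, so both graphs have \<open>n\<close> vertices.\<close>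
    hence "k + sigma t \<le> n" using card_mono[OF fin] G(2) by metis
    hence "card (verts G) = card (verts ?H)" using H(2) G(2) by simp
    from quasi_complete_isomorphic[OF fin H(1) this q H(3)] obtain f where
      "bij_betw f (verts G) (verts ?H)"
      "\<And>u v. u \<in> verts G \<Longrightarrow> v \<in> verts G \<Longrightarrow> (u, v) \<in> rel_of G \<longleftrightarrow> (f u, f v) \<in> rel_of ?H"
      by metis
    thus "graph_iso G ?H" unfolding graph_iso_def rel_of_def by auto
  }
qed

section \<open>The parameters \<open>k\<close> and \<open>t\<close>, and the entropy bound\<close>

lemma triangular_decomposition:
  fixes k m t :: nat
  assumes m: "1 \<le> m" and k: "k = Max {j. j choose 2 \<le> m}" and t: "t = m - (k choose 2)"
  shows "2 \<le> k" "t < k" "2 * m = k * (k - 1) + 2 * t"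
proof -
  let ?J = "{j. j choose 2 \<le> m}"
  \<comment> \<open>As \<open>j choose 2\<close> is at least \<open>j - 1\<close>, the set is finite
    and its maximum is attained.\<close>
  have "j \<le> m + 1" if "j choose 2 \<le> m" for j
  proof (cases j)
    case (Suc i)
    hence "i \<le> j choose 2" by (simp add: numeral_2_eq_2)
    thus ?thesis using that Suc by simp
  qed simp
  hence "finite ?J" by (intro finite_subset[of ?J "{..m + 1}"]) auto
  moreover have "2 \<in> ?J" using m by simp
  ultimately have "k \<in> ?J" and max: "\<And>j. j \<in> ?J \<Longrightarrow> j \<le> k"
    unfolding k using Max_in[of ?J] Max_ge[of ?J] by blast+
  hence le: "k choose 2 \<le> m" by simp
  show "2 \<le> k" using max \<open>2 \<in> ?J\<close> by simp
  \<comment> \<open>By maximality \<open>m\<close> is below \<open>Suc k choose 2\<close>, which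
    exceeds \<open>k choose 2\<close> by exactly \<open>k\<close>; hence
    \<open>t < k\<close>.\<close>
  have "Suc k \<notin> ?J" using max[of "Suc k"] by auto
  moreover have "Suc k choose 2 = k + (k choose 2)" by (simp add: numeral_2_eq_2)
  ultimately show "t < k" using le t by simp
  have "even (k * (k - 1))" by (cases k) auto
  hence "2 * (k choose 2) = k * (k - 1)" by (simp add: choose_two)
  thus "2 * m = k * (k - 1) + 2 * t" using le t by simp
qed

theorem theorem1:
  fixes G :: "'a ugraph" and n m k t :: nat
  assumes "n \<ge> 2" and "1 \<le> m" and "m \<le> n choose 2"
    and "simple_graph G" and "card (verts G) = n" and "card (edges G) = m"
    and "k = Max {j. j choose 2 \<le> m}" and "t = m - (k choose 2)"
  shows "let B = log 2 (2 * real m) -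
                 (real t * real k * log 2 (real k)
                  + (real k - real t) * (real k - 1) * log 2 (real k - 1)
                  + real t * log 2 (real t)) / (2 * real m)
         in degree_entropy G \<ge> B \<and>
            (degree_entropy G = B \<longleftrightarrow>
             graph_iso G (disjoint_union (K_ext k t) (complement_graph (complete_graph (n - k - sigma t)))))"
proof -
  note kt = triangular_decomposition[OF assms(2,7,8)]
  let ?E = "energy (verts G) (rel_of G)"
  have R: "graph_rel (verts G) (rel_of G)" "card (rel_of G) = k * (k - 1) + 2 * t"
    using graph_rel_rel_of[OF assms(4)] card_rel_of[OF assms(4)] kt(3) assms(6) by simp_all
  \<comment> \<open>With \<open>k = Suc a\<close>, the natural \<open>k - 1\<close> of
    \<open>extremal_energy\<close> matches the real \<open>k - 1\<close> of the statement.\<close>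
  obtain a where a: "k = Suc a" using kt(1) by (cases k) auto
  have B: "(real t * real k * log 2 (real k) + (real k - real t) * (real k - 1) * log 2 (real k - 1)
      + real t * log 2 (real t)) = extremal_energy k t / ln 2"
    by (simp add: a extremal_energy_def gap_def xlnx_def log_def field_simps)
  have "?E \<le> extremal_energy k t" "?E = extremal_energy k t \<longleftrightarrow> quasi_complete (verts G) k t (rel_of G)"
    using energy_le[OF R kt(2)] energy_eq_iff[OF R kt(2,1)] by auto
  moreover have "degree_entropy G = log 2 (2 * real m) - ?E / ln 2 / (2 * real m)"
    using assms(2) by (intro degree_entropy_eq[OF assms(4,6)]) simp
  moreover have cancel: "x / z \<le> y / z \<longleftrightarrow> x \<le> y" "x / z = y / z \<longleftrightarrow> x = y" if "0 < z" for x y z :: real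
    using that by (auto simp: divide_le_cancel)
  \<comment> \<open>The entropy is an affine, decreasing function of the energy. Cancelling this
    positive factor carries over both the inequality and the equality case.\<close>
  have "0 < ln 2 * (2 * real m)" using assms(2) by simp
  note cancel[OF this]
  ultimately show ?thesis
    unfolding Let_def B divide_divide_eq_left using graph_iso_quasi_complete_iff[OF assms(4,5)] kt(2) by auto
qed

end
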